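(* For any connected graph $G$, any $\gamma\in(\mathbb R_+)^{|V|}$, any rewards $w$, any error cdf's $F$ and any $\lambda\in(0,\infty)^{|V|}$, the model $(G,\textsc{mw}_{w,F},\lambda,\gamma)$ is stable (i.e. the continuous-time Markov chain $(X_t)_{t\ge0}$ is positive recurrent) if and only if $\lambda$ belongs to the set $$\textsc{Ncond}(G,\gamma)=\Big\{\lambda\in(0,\infty)^{|V|}:\lambda(I)<\lambda(E(I))\text{ for any }I\in\mathbb I(R^c)\Big\}.$$
   Context: Setting. $G=(V,E)$ is a finite, simple, undirected, connected graph; edges are written $\langle i,j\rangle$. For $A\subset V$, $E(A)=\{i\in V:\langle i,j\rangle\in E\text{ for some }j\in A\}$ and $E(i)=E(\{i\})$. An independent set is a nonempty $I\subset V$ such that $i,j\in I$ implies $\langle i,j\rangle\notin E$; $\mathbb I(A)$ is the set of independent sets contained in $A$. Arrival rates: $\lambda=(\lambda(i))_{i\in V}$ with $\lambda(i)>0$; $\lambda(A)=\sum_{i\in A}\lambda(i)$. Reneging rates: $\gamma=(\gamma(i))_{i\in V}$ with $\gamma(i)\ge0$; $R=\{i\in V:\gamma(i)>0\}$, $R^c=\{i\in V:\gamma(i)=0\}$. Rewards: $w=(w_{(j,i)})$, nonnegative numbers indexed by ordered pairs $(j,i)$ with $\langle i,j\rangle\in E$ (not assumed symmetric). Errors: $F=(F_{(j,i)})$ is a family of cumulative distribution functions, and $U_{(j,i)}$ ($\langle i,j\rangle\in E$) are mutually independent real random variables, $U_{(j,i)}$ having cdf $F_{(j,i)}$. State space: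 $\mathcal X=\{x\in\mathbb N_0^{V}:x(i)x(j)=0\text{ whenever }\langle i,j\rangle\in E\}$; $\mathrm{supp}(x)=\{i:x(i)>0\}$; $\delta_i$ is the $i$-th canonical vector. Model $(G,\textsc{mw}_{w,F},\lambda,\gamma)$ (generalized Max-Weight policy): class-$i$ items arrive according to independent Poisson processes of rate $\lambda(i)$; each stored $i$-item independently reneges at rate $\gamma(i)$; an arriving $j$-item that finds no stored item with class in $E(j)$ is stored; otherwise it is immediately matched (both items leave) with a stored item whose class is chosen uniformly at random in $\arg\max_{i\in E(j):x(i)>0}\big([x(i)+U_{(j,i)}]^++w_{(j,i)}\big)$, where $x$ is the current queue-length vector and the errors $U_{(j,i)}$ are drawn afresh at each arrival, independently of everything else. For $j\in V$ and $i\in E(j)$, $\nu_{x,j}(i)$ denotes the probability that an arriving $j$-item in state $x$ is matched with an $i$-item. The queue-length process $X=(X_t)_{t\ge0}$ is the continuous-time Markov chain on $\mathcal X$ with generator $$\mathcal Lf(x)=\sum_{i\notin E(\mathrm{supp}(x))}\lambda(i)[f(x+\delta_i)-f(x)]+\sum_{i\in\mathrm{supp}(x)}\Big[\gamma(i)x(i)+\sum_{j\in E(i)}\lambda(j)\nu_{x,j}(i)\Big][f(x-\delta_i)-f(x)].$$ *)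

theory Defs
  imports "HOL-Probability.Probability"
begin

section \<open>Continuous-time Markov chains on a countable state space\<close>

text \<open>
  A generator is given as an operator \<open>L\<close> on functions. Its transition rates are
  \<open>q(x,y) = L 1\<^sub>y (x)\<close> for \<open>y \<noteq> x\<close>, and \<open>q(x) = - L 1\<^sub>x (x)\<close> is the total rate
  out of \<open>x\<close>.
\<close>

definition transition_rate :: "(('s \<Rightarrow> real) \<Rightarrow> 's \<Rightarrow> real) \<Rightarrow> 's \<Rightarrow> 's \<Rightarrow> real" where
  "transition_rate L x y = L (indicator {y}) x"

definition exit_rate :: "(('s \<Rightarrow> real) \<Rightarrow> 's \<Rightarrow> real) \<Rightarrow> 's \<Rightarrow> real" where
  "exit_rate L x = - transition_rate L x x"

definition jump_kernel :: "(('s \<Rightarrow> real) \<Rightarrow> 's \<Rightarrow> real) \<Rightarrow> 's \<Rightarrow> 's pmf" where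
  "jump_kernel L x =
     (if exit_rate L x = 0 then return_pmf x
      else embed_pmf (\<lambda>y. if y = x then 0 else transition_rate L x y / exit_rate L x))"

lemma pmf_jump_kernel:
  fixes x :: 's
  assumes fin: "finite {y. transition_rate L x y \<noteq> 0}"
    and nonneg: "\<And>y. y \<noteq> x \<Longrightarrow> 0 \<le> transition_rate L x y"
    and conservative: "(\<Sum>y | transition_rate L x y \<noteq> 0. transition_rate L x y) = 0"
    and nz: "exit_rate L x \<noteq> 0"
  shows "pmf (jump_kernel L x) y = (if y = x then 0 else transition_rate L x y / exit_rate L x)"
proof -
  let ?S = "{y. transition_rate L x y \<noteq> 0}"
  let ?f = "\<lambda>y. if y = x then 0 else transition_rate L x y / exit_rate L x"
  have xS: "x \<in> ?S" using nz by (simp add: exit_rate_def)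
  have off: "(\<Sum>y\<in>?S - {x}. transition_rate L x y) = exit_rate L x"
    using conservative sum.remove[OF fin xS, of "transition_rate L x"]
    by (simp add: exit_rate_def)
  then have "0 \<le> exit_rate L x"
    using sum_nonneg[of "?S - {x}" "transition_rate L x"] nonneg by auto
  then have f0: "0 \<le> ?f y" for y using nonneg by auto
  have "(\<integral>\<^sup>+y. ennreal (?f y) \<partial>count_space UNIV) = (\<Sum>y\<in>?S - {x}. ennreal (?f y))"
    using fin by (intro nn_integral_count_space') auto
  also have "\<dots> = ennreal (\<Sum>y\<in>?S - {x}. ?f y)"
    using f0 by (intro sum_ennreal) blast
  also have "(\<Sum>y\<in>?S - {x}. ?f y) = (\<Sum>y\<in>?S - {x}. transition_rate L x y) / exit_rate L x"
    unfolding sum_divide_distrib by (intro sum.cong) auto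
  also have "ennreal \<dots> = 1" using off nz by simp
  finally show ?thesis
    using nz f0 by (simp add: jump_kernel_def pmf_embed_pmf)
qed

text \<open>
  The chain is realised by its jump chain and holding times, the minimal (possibly explosive)
  construction. The probability space consists of an independent sequence of pairs: a successor
  drawn independently for every state \<open>y\<close> from \<open>jump_kernel L y\<close> (at each step only the
  successor of the current state is used), and an independent standard exponential
  variable, which is divided by the exit rate of the current state to give the holding time.
\<close>

definition ctmc_space :: "(('s \<Rightarrow> real) \<Rightarrow> 's \<Rightarrow> real) \<Rightarrow> (('s \<Rightarrow> 's) \<times> real) stream measure" where
  "ctmc_space L =
     stream_space (PiM UNIV (\<lambda>y. measure_pmf (jump_kernel L y))
                   \<Otimes>\<^sub>M density lborel (exponential_density 1))"

primrec jump_chain :: "'s \<Rightarrow> (('s \<Rightarrow> 's) \<times> real) stream \<Rightarrow> nat \<Rightarrow> 's" where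
  "jump_chain x \<omega> 0 = x"
| "jump_chain x \<omega> (Suc n) = fst (\<omega> !! n) (jump_chain x \<omega> n)"

text \<open>In \<open>ennreal\<close>, a positive number divided by \<open>0\<close> is \<open>\<infinity>\<close>: absorbing states are held forever.\<close>

definition holding_time ::
  "(('s \<Rightarrow> real) \<Rightarrow> 's \<Rightarrow> real) \<Rightarrow> 's \<Rightarrow> (('s \<Rightarrow> 's) \<times> real) stream \<Rightarrow> nat \<Rightarrow> ennreal" where
  "holding_time L x \<omega> n =
     ennreal (snd (\<omega> !! n)) / ennreal (exit_rate L (jump_chain x \<omega> n))"

definition jump_time ::
  "(('s \<Rightarrow> real) \<Rightarrow> 's \<Rightarrow> real) \<Rightarrow> 's \<Rightarrow> (('s \<Rightarrow> 's) \<times> real) stream \<Rightarrow> nat \<Rightarrow> ennreal" where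
  "jump_time L x \<omega> n = (\<Sum>k<n. holding_time L x \<omega> k)"

text \<open>
  \<open>ctmc L x t \<omega>\<close> is the state at time \<open>t \<ge> 0\<close> of the chain started from \<open>x\<close>;
  it is \<open>None\<close> from the explosion time on.
\<close>

definition ctmc ::
  "(('s \<Rightarrow> real) \<Rightarrow> 's \<Rightarrow> real) \<Rightarrow> 's \<Rightarrow> real \<Rightarrow> (('s \<Rightarrow> 's) \<times> real) stream \<Rightarrow> 's option" where
  "ctmc L x t \<omega> =
     (if \<exists>n. jump_time L x \<omega> n \<le> ennreal t \<and> ennreal t < jump_time L x \<omega> (Suc n)
      then Some (jump_chain x \<omega>
        (THE n. jump_time L x \<omega> n \<le> ennreal t \<and> ennreal t < jump_time L x \<omega> (Suc n)))
      else None)"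

definition return_time ::
  "(('s \<Rightarrow> real) \<Rightarrow> 's \<Rightarrow> real) \<Rightarrow> 's \<Rightarrow> (('s \<Rightarrow> 's) \<times> real) stream \<Rightarrow> ennreal" where
  "return_time L x \<omega> =
     (INF t\<in>{t. 0 \<le> t \<and> jump_time L x \<omega> 1 \<le> ennreal t \<and> ctmc L x t \<omega> = Some x}. ennreal t)"

definition positive_recurrent_state :: "(('s \<Rightarrow> real) \<Rightarrow> 's \<Rightarrow> real) \<Rightarrow> 's \<Rightarrow> bool" where
  "positive_recurrent_state L x \<longleftrightarrow>
     exit_rate L x = 0 \<or> (\<integral>\<^sup>+\<omega>. return_time L x \<omega> \<partial>ctmc_space L) < \<infinity>"

definition positive_recurrent :: "(('s \<Rightarrow> real) \<Rightarrow> 's \<Rightarrow> real) \<Rightarrow> 's set \<Rightarrow> bool" where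
  "positive_recurrent L S \<longleftrightarrow> (\<forall>x\<in>S. positive_recurrent_state L x)"


section \<open>Graphs and independent sets\<close>

text \<open>The vertex set is the finite type \<open>'v\<close>; \<open>E\<close> contains both orientations of every edge.\<close>

definition connected_simple_graph :: "('v::finite \<times> 'v) set \<Rightarrow> bool" where
  "connected_simple_graph E \<longleftrightarrow> sym E \<and> irrefl E \<and> (\<forall>i j. (i, j) \<in> E\<^sup>*)"

definition neighbours :: "('v \<times> 'v) set \<Rightarrow> 'v set \<Rightarrow> 'v set" where
  "neighbours E A = {i. \<exists>j\<in>A. (i, j) \<in> E}"

definition independent_sets :: "('v \<times> 'v) set \<Rightarrow> 'v set \<Rightarrow> 'v set set" where
  "independent_sets E A = {I. I \<noteq> {} \<and> I \<subseteq> A \<and> (\<forall>i\<in>I. \<forall>j\<in>I. (i, j) \<notin> E)}"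

definition Ncond :: "('v::finite \<times> 'v) set \<Rightarrow> ('v \<Rightarrow> real) \<Rightarrow> ('v \<Rightarrow> real) set" where
  "Ncond E \<gamma> =
     {lam. (\<forall>i. 0 < lam i) \<and>
           (\<forall>I\<in>independent_sets E {i. \<gamma> i = 0}. sum lam I < sum lam (neighbours E I))}"


section \<open>The matching model with the generalized Max-Weight policy\<close>

definition states :: "('v \<times> 'v) set \<Rightarrow> ('v \<Rightarrow> nat) set" where
  "states E = {x. \<forall>(i, j)\<in>E. x i * x j = 0}"

definition supp :: "('v \<Rightarrow> nat) \<Rightarrow> 'v set" where
  "supp x = {i. 0 < x i}"

definition is_cdf :: "(real \<Rightarrow> real) \<Rightarrow> bool" where
  "is_cdf F \<longleftrightarrow> (\<exists>M. real_distribution M \<and> F = cdf M)"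

text \<open>
  Joint law of the errors: the coordinates \<open>u (j, i)\<close>, \<open>(j, i) \<in> E\<close>, are independent with
  cdf \<open>F (j, i)\<close>.
\<close>

definition errors :: "('v \<times> 'v) set \<Rightarrow> ('v \<times> 'v \<Rightarrow> real \<Rightarrow> real) \<Rightarrow> ('v \<times> 'v \<Rightarrow> real) measure" where
  "errors E F = PiM E (\<lambda>e. interval_measure (F e))"

definition mw_argmax ::
  "('v \<times> 'v) set \<Rightarrow> ('v \<times> 'v \<Rightarrow> real) \<Rightarrow> ('v \<Rightarrow> nat) \<Rightarrow> 'v \<Rightarrow> ('v \<times> 'v \<Rightarrow> real) \<Rightarrow> 'v set" where
  "mw_argmax E w x j u =
     {i. is_arg_max (\<lambda>i. max 0 (real (x i) + u (j, i)) + w (j, i))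
                    (\<lambda>i. i \<in> neighbours E {j} \<and> 0 < x i) i}"

text \<open>
  \<open>match_prob E w F x j i\<close> is \<open>\<nu>\<^bsub>x,j\<^esub>(i)\<close>. Given the errors, the matched class is uniform on
  the argmax; if no compatible item is stored, the argmax is empty and the probability is \<open>0\<close>.
\<close>

definition match_prob ::
  "('v \<times> 'v) set \<Rightarrow> ('v \<times> 'v \<Rightarrow> real) \<Rightarrow> ('v \<times> 'v \<Rightarrow> real \<Rightarrow> real)
    \<Rightarrow> ('v \<Rightarrow> nat) \<Rightarrow> 'v \<Rightarrow> 'v \<Rightarrow> real" where
  "match_prob E w F x j i =
     (\<integral>u. indicator (mw_argmax E w x j u) i / real (card (mw_argmax E w x j u)) \<partial>errors E F)"

definition mw_generator ::
  "('v::finite \<times> 'v) set \<Rightarrow> ('v \<times> 'v \<Rightarrow> real) \<Rightarrow> ('v \<times> 'v \<Rightarrow> real \<Rightarrow> real)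
    \<Rightarrow> ('v \<Rightarrow> real) \<Rightarrow> ('v \<Rightarrow> real) \<Rightarrow> (('v \<Rightarrow> nat) \<Rightarrow> real) \<Rightarrow> ('v \<Rightarrow> nat) \<Rightarrow> real" where
  "mw_generator E w F lam \<gamma> f x =
     (\<Sum>i\<in>- neighbours E (supp x). lam i * (f (x(i := x i + 1)) - f x)) +
     (\<Sum>i\<in>supp x.
        (\<gamma> i * real (x i) + (\<Sum>j\<in>neighbours E {i}. lam j * match_prob E w F x j i)) *
        (f (x(i := x i - 1)) - f x))"

definition mw_stable ::
  "('v::finite \<times> 'v) set \<Rightarrow> ('v \<times> 'v \<Rightarrow> real) \<Rightarrow> ('v \<times> 'v \<Rightarrow> real \<Rightarrow> real)
    \<Rightarrow> ('v \<Rightarrow> real) \<Rightarrow> ('v \<Rightarrow> real) \<Rightarrow> bool" where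
  "mw_stable E w F lam \<gamma> \<longleftrightarrow> positive_recurrent (mw_generator E w F lam \<gamma>) (states E)"

end

(*
  The jump chain already decides the matter: holding times have conditional mean 1/q(x), where
  q(x) is the exit rate, and q is bounded below, so a finite mean number of jumps until the
  return gives a finite mean return time.

  Sufficiency. The quadratic function V has drift at most K - b |x| - q(x). The classes with
  reneging contribute negative quadratic terms. For the others, write x as the sum of the
  indicators of its level sets, which are independent: the condition applied to each level set
  bounds the arrivals by the matches that an exact Max-Weight rule would produce. The errors need
  no moments, since tightness only costs a small proportion of the longest queue. Hence V
  decreases by at least 1 per jump outside a finite set, and inside a finite set V is corrected by
  a multiple of 1 - theta^d, where d is the distance to the target state.

  Necessity. If I violates the condition, f = x(I) - x(E(I)) has nonnegative drift, as an arrival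
  in I raises f by 1, an arrival in E(I) lowers it by at most 1, and no other event lowers it. So
  g = max 0 f is a submartingale on excursions from the empty state. With positive recurrence,
  the mean number of downward steps of g in an excursion would be finite, as these occur at a
  bounded rate. But g must descend to 0 by steps of size at most 1, so the mean of g after n jumps
  is at most the mean number of downward steps after time n, which tends to 0; yet it is bounded
  below by the mean of g after the first jump.
*)
theory Submission
  imports Defs
begin

section \<open>First-step analysis of the jump chain\<close>

abbreviation step_space :: "(('s \<Rightarrow> real) \<Rightarrow> 's \<Rightarrow> real) \<Rightarrow> (('s \<Rightarrow> 's) \<times> real) measure" where
  "step_space L \<equiv> PiM UNIV (\<lambda>y. measure_pmf (jump_kernel L y))
                   \<Otimes>\<^sub>M density lborel (exponential_density 1)"

lemma prob_space_step_space: "prob_space (step_space L)"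
  by (intro prob_space_pair prob_space_PiM measure_pmf.prob_space_axioms
      prob_space_exponential_density) simp

lemma measurable_successor [measurable]:
  "(\<lambda>a. fst a y) \<in> step_space L \<rightarrow>\<^sub>M count_space UNIV"
proof -
  have "(\<lambda>s. s y) \<in> PiM UNIV (\<lambda>y. measure_pmf (jump_kernel L y)) \<rightarrow>\<^sub>M measure_pmf (jump_kernel L y)"
    by (rule measurable_component_singleton) simp
  then have "(\<lambda>s. s y) \<in> PiM UNIV (\<lambda>y. measure_pmf (jump_kernel L y)) \<rightarrow>\<^sub>M count_space UNIV"
    by (simp cong: measurable_cong_sets)
  then show ?thesis by (rule measurable_compose[OF measurable_fst])
qed

lemma measurable_holding [measurable]: "snd \<in> borel_measurable (step_space L)"
proof -
  have "snd \<in> step_space L \<rightarrow>\<^sub>M density lborel (exponential_density 1)"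
    by (rule measurable_snd)
  then show ?thesis by (simp cong: measurable_cong_sets)
qed

lemma measurable_ctmc_space_snth [measurable]: "(\<lambda>\<omega>. \<omega> !! n) \<in> ctmc_space L \<rightarrow>\<^sub>M step_space L"
  unfolding ctmc_space_def by (rule measurable_snth)

lemma measurable_jump_chain [measurable]:
  fixes L :: "(('s::countable \<Rightarrow> real) \<Rightarrow> 's \<Rightarrow> real)"
  shows "(\<lambda>\<omega>. jump_chain x \<omega> n) \<in> ctmc_space L \<rightarrow>\<^sub>M count_space UNIV"
proof (induction n)
  case 0
  then show ?case by simp
next
  case (Suc n)
  have "(\<lambda>\<omega>. fst (\<omega> !! n) (jump_chain x \<omega> n)) \<in> ctmc_space L \<rightarrow>\<^sub>M count_space UNIV"
  proof (rule measurable_compose_countable[OF _ Suc])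
    fix y
    show "(\<lambda>\<omega>. fst (\<omega> !! n) y) \<in> ctmc_space L \<rightarrow>\<^sub>M count_space UNIV"
      by (rule measurable_compose[OF measurable_ctmc_space_snth measurable_successor])
  qed
  then show ?case by simp
qed

text \<open>Only coordinate \<open>y\<close> of the successor map matters: its marginal under the
  product is \<open>jump_kernel L y\<close>, and the exponential factor integrates to 1. This is how
  averages over a random step become averages over the jump kernel.\<close>

lemma nn_integral_successor:
  fixes L :: "(('s::countable \<Rightarrow> real) \<Rightarrow> 's \<Rightarrow> real)"
  shows "(\<integral>\<^sup>+a. h (fst a y) \<partial>step_space L) = (\<integral>\<^sup>+z. h z \<partial>measure_pmf (jump_kernel L y))"
proof -
  interpret B: prob_space "density lborel (exponential_density 1)"
    by (rule prob_space_exponential_density) simp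
  have m: "(\<lambda>a. h (fst a y)) \<in> borel_measurable (step_space L)"
    by (rule measurable_compose[OF measurable_successor]) simp
  have m2: "(\<lambda>s. s y) \<in> PiM UNIV (\<lambda>y. measure_pmf (jump_kernel L y)) \<rightarrow>\<^sub>M measure_pmf (jump_kernel L y)"
    by (rule measurable_component_singleton) simp
  have "(\<integral>\<^sup>+a. h (fst a y) \<partial>step_space L)
      = (\<integral>\<^sup>+s. \<integral>\<^sup>+e. h (s y) \<partial>density lborel (exponential_density 1) \<partial>PiM UNIV (\<lambda>y. measure_pmf (jump_kernel L y)))"
    by (subst B.nn_integral_fst[symmetric, OF m]) simp
  also have "\<dots> = (\<integral>\<^sup>+s. h (s y) \<partial>PiM UNIV (\<lambda>y. measure_pmf (jump_kernel L y)))"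
    by (simp add: B.emeasure_space_1 del: space_density)
  also have "\<dots> = (\<integral>\<^sup>+z. h z \<partial>distr (PiM UNIV (\<lambda>y. measure_pmf (jump_kernel L y)))
      (measure_pmf (jump_kernel L y)) (\<lambda>s. s y))"
    by (rule nn_integral_distr[symmetric, OF m2]) simp
  also have "distr (PiM UNIV (\<lambda>y. measure_pmf (jump_kernel L y)))
      (measure_pmf (jump_kernel L y)) (\<lambda>s. s y) = measure_pmf (jump_kernel L y)"
    by (rule distr_PiM_component) (auto simp: measure_pmf.prob_space_axioms)
  finally show ?thesis .
qed

lemma nn_integral_exponential_1:
  "(\<integral>\<^sup>+e. ennreal e \<partial>density lborel (exponential_density 1)) = 1"
proof -
  have "(\<integral>\<^sup>+e. ennreal e \<partial>density lborel (exponential_density 1))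
      = (\<integral>\<^sup>+e. ennreal (exponential_density 1 e) * ennreal e \<partial>lborel)"
    by (rule nn_integral_density) auto
  also have "\<dots> = (\<integral>\<^sup>+e. ennreal (e ^ 1 * exp (- e)) * indicator {0..} e \<partial>lborel)"
    by (intro nn_integral_cong)
      (auto simp: exponential_density_def ennreal_mult'[symmetric] mult.commute split: split_indicator)
  finally show ?thesis by (simp only: nn_intergal_power_times_exp_Ici) simp
qed

lemma nn_integral_holding: "(\<integral>\<^sup>+a. ennreal (snd a) \<partial>step_space L) = 1"
proof -
  interpret A: prob_space "PiM UNIV (\<lambda>y. measure_pmf (jump_kernel L y))"
    by (intro prob_space_PiM measure_pmf.prob_space_axioms)
  interpret B: prob_space "density lborel (exponential_density 1)"
    by (rule prob_space_exponential_density) simp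
  have m: "(\<lambda>a. ennreal (snd a)) \<in> borel_measurable (step_space L)" by measurable
  have "(\<integral>\<^sup>+a. ennreal (snd a) \<partial>step_space L)
     = (\<integral>\<^sup>+s. \<integral>\<^sup>+e. ennreal e \<partial>density lborel (exponential_density 1) \<partial>PiM UNIV (\<lambda>y. measure_pmf (jump_kernel L y)))"
    by (subst B.nn_integral_fst[symmetric, OF m]) simp
  also have "\<dots> = 1" by (simp only: nn_integral_exponential_1) (simp add: A.emeasure_space_1)
  finally show ?thesis .
qed

lemma AE_holding_pos: "AE a in step_space L. 0 < snd a"
proof -
  interpret A: prob_space "PiM UNIV (\<lambda>y. measure_pmf (jump_kernel L y))"
    by (intro prob_space_PiM measure_pmf.prob_space_axioms)
  interpret B: prob_space "density lborel (exponential_density 1)"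
    by (rule prob_space_exponential_density) simp
  interpret AB: pair_prob_space "PiM UNIV (\<lambda>y. measure_pmf (jump_kernel L y))"
    "density lborel (exponential_density 1)" ..
  have "AE e in lborel. e \<noteq> (0::real)" by (rule AE_lborel_singleton)
  then have "AE e in density lborel (exponential_density 1). 0 < e"
    by (subst AE_density) (auto simp: exponential_density_def)
  then have "AE s in PiM UNIV (\<lambda>y. measure_pmf (jump_kernel L y)).
    AE e in density lborel (exponential_density 1). 0 < snd (s, e)" by simp
  moreover have "{a \<in> space (step_space L). 0 < snd a} \<in> sets (step_space L)"
    by measurable
  ultimately show ?thesis
    by (intro AB.AE_pair_measure)
qed

lemma AE_holdings_pos: "AE \<omega> in ctmc_space L. \<forall>n. 0 < snd (\<omega> !! n)"
proof -
  interpret prob_space "step_space L" by (rule prob_space_step_space)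
  have "AE \<omega> in stream_space (step_space L). stream_all (\<lambda>a. 0 < snd a) \<omega>"
    by (rule AE_stream_all[OF _ AE_holding_pos]) measurable
  then show ?thesis unfolding ctmc_space_def stream_all_def .
qed

section \<open>Path costs accumulated before hitting a given state\<close>

text \<open>The transition operator of the jump chain killed at \<open>x\<close>: paths standing at
  \<open>x\<close> contribute nothing. Applied to a function vanishing at \<open>x\<close>, the
  \<open>k\<close>-th iterate averages over paths that avoid \<open>x\<close> at times 0 to
  \<open>k\<close>.\<close>

definition killed :: "(('s \<Rightarrow> real) \<Rightarrow> 's \<Rightarrow> real) \<Rightarrow> 's \<Rightarrow> ('s \<Rightarrow> ennreal) \<Rightarrow> 's \<Rightarrow> ennreal" where
  "killed L x h y = (if y = x then 0 else \<integral>\<^sup>+z. h z \<partial>measure_pmf (jump_kernel L y))"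

lemma jump_chain_Stream: "jump_chain x (a ## \<omega>) (Suc n) = jump_chain (fst a x) \<omega> n"
  by (induction n) auto

lemma measurable_path_cost [measurable]:
  fixes L :: "(('s::countable \<Rightarrow> real) \<Rightarrow> 's \<Rightarrow> real)"
  assumes [measurable]: "\<And>y. c y \<in> borel_measurable (step_space L)"
  shows "(\<lambda>\<omega>. c (jump_chain y \<omega> k) (\<omega> !! k) :: ennreal) \<in> borel_measurable (ctmc_space L)"
  by (rule measurable_compose_countable[OF _ measurable_jump_chain]) measurable

text \<open>Splitting off the head of the stream leaves an independent fresh path from the first
  successor, so induction on \<open>k\<close> applies. The pair drawn at time \<open>k\<close> is
  independent of the state reached by then, hence only its mean cost survives. Letting
  \<open>c\<close> read that pair covers both holding times and indicators of downward
  jumps.\<close>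

lemma nn_integral_path_cost:
  fixes L :: "(('s::countable \<Rightarrow> real) \<Rightarrow> 's \<Rightarrow> real)" and c :: "'s \<Rightarrow> ('s \<Rightarrow> 's) \<times> real \<Rightarrow> ennreal"
  assumes [measurable]: "\<And>y. c y \<in> borel_measurable (step_space L)"
  shows "(\<integral>\<^sup>+\<omega>. (if \<forall>j\<le>k. jump_chain y \<omega> j \<noteq> x then c (jump_chain y \<omega> k) (\<omega> !! k) else 0) \<partial>ctmc_space L)
     = (killed L x ^^ k) (\<lambda>y. if y = x then 0 else \<integral>\<^sup>+a. c y a \<partial>step_space L) y"
proof (induction k arbitrary: y)
  case 0
  interpret prob_space "step_space L" by (rule prob_space_step_space)
  interpret S: prob_space "stream_space (step_space L)" by (rule prob_space_stream_space)
  have "(\<integral>\<^sup>+\<omega>. c y (\<omega> !! 0) \<partial>ctmc_space L) = (\<integral>\<^sup>+a. c y a \<partial>step_space L)"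
    unfolding ctmc_space_def
    by (subst nn_integral_stream_space) (auto simp: S.emeasure_space_1)
  then show ?case by auto
next
  case (Suc k)
  interpret prob_space "step_space L" by (rule prob_space_step_space)
  have [measurable]: "(\<lambda>\<omega>. c (jump_chain y \<omega> k) (\<omega> !! k) :: ennreal) \<in> borel_measurable (stream_space (step_space L))" for y k
    using measurable_path_cost[of c L] unfolding ctmc_space_def by auto
  have [measurable]: "(\<lambda>\<omega>. jump_chain y \<omega> k) \<in> stream_space (step_space L) \<rightarrow>\<^sub>M count_space UNIV" for y k
    using measurable_jump_chain[of y k L] unfolding ctmc_space_def by auto
  have all: "(\<forall>j\<le>Suc k. jump_chain y (a ## \<omega>) j \<noteq> x) \<longleftrightarrow>
      y \<noteq> x \<and> (\<forall>j\<le>k. jump_chain (fst a y) \<omega> j \<noteq> x)" for a \<omega>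
    using jump_chain_Stream[of y a \<omega>]
    by (auto simp: less_Suc_eq_le[symmetric] All_less_Suc2 simp del: jump_chain.simps(2))
  have "(\<integral>\<^sup>+\<omega>. (if \<forall>j\<le>Suc k. jump_chain y \<omega> j \<noteq> x
      then c (jump_chain y \<omega> (Suc k)) (\<omega> !! Suc k) else 0) \<partial>ctmc_space L)
    = (\<integral>\<^sup>+a. \<integral>\<^sup>+\<omega>. (if \<forall>j\<le>Suc k. jump_chain y (a ## \<omega>) j \<noteq> x
      then c (jump_chain y (a ## \<omega>) (Suc k)) ((a ## \<omega>) !! Suc k) else 0) \<partial>stream_space (step_space L) \<partial>step_space L)"
    unfolding ctmc_space_def by (rule nn_integral_stream_space) measurable
  also have "\<dots> = (\<integral>\<^sup>+a. (if y = x then 0 else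
      (killed L x ^^ k) (\<lambda>y. if y = x then 0 else \<integral>\<^sup>+a. c y a \<partial>step_space L) (fst a y)) \<partial>step_space L)"
    unfolding all jump_chain_Stream snth_Stream
    using Suc by (intro nn_integral_cong) (simp add: ctmc_space_def)
  also have "\<dots> = killed L x ((killed L x ^^ k) (\<lambda>y. if y = x then 0 else \<integral>\<^sup>+a. c y a \<partial>step_space L)) y"
    unfolding killed_def by (subst nn_integral_successor) auto
  finally show ?case by simp
qed

text \<open>The path starts in \<open>x\<close> itself, so its first step must be taken without
  killing; the excursion begins at time 1, which shifts all indices by one.\<close>

lemma nn_integral_excursion_cost:
  fixes L :: "(('s::countable \<Rightarrow> real) \<Rightarrow> 's \<Rightarrow> real)" and c :: "'s \<Rightarrow> ('s \<Rightarrow> 's) \<times> real \<Rightarrow> ennreal"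
  assumes [measurable]: "\<And>y. c y \<in> borel_measurable (step_space L)"
  shows "(\<integral>\<^sup>+\<omega>. (if \<forall>j\<le>k. jump_chain x \<omega> (Suc j) \<noteq> x
            then c (jump_chain x \<omega> (Suc k)) (\<omega> !! Suc k) else 0) \<partial>ctmc_space L)
     = (\<integral>\<^sup>+z. (killed L x ^^ k) (\<lambda>y. if y = x then 0 else \<integral>\<^sup>+a. c y a \<partial>step_space L) z
          \<partial>measure_pmf (jump_kernel L x))"
proof -
  interpret prob_space "step_space L" by (rule prob_space_step_space)
  have [measurable]: "(\<lambda>\<omega>. c (jump_chain y \<omega> k) (\<omega> !! k) :: ennreal) \<in> borel_measurable (stream_space (step_space L))" for y k
    using measurable_path_cost[of c L] unfolding ctmc_space_def by auto
  have [measurable]: "(\<lambda>\<omega>. jump_chain y \<omega> k) \<in> stream_space (step_space L) \<rightarrow>\<^sub>M count_space UNIV" for y k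
    using measurable_jump_chain[of y k L] unfolding ctmc_space_def by auto
  have "(\<integral>\<^sup>+\<omega>. (if \<forall>j\<le>k. jump_chain x \<omega> (Suc j) \<noteq> x
            then c (jump_chain x \<omega> (Suc k)) (\<omega> !! Suc k) else 0) \<partial>ctmc_space L)
    = (\<integral>\<^sup>+a. \<integral>\<^sup>+\<omega>. (if \<forall>j\<le>k. jump_chain x (a ## \<omega>) (Suc j) \<noteq> x
      then c (jump_chain x (a ## \<omega>) (Suc k)) ((a ## \<omega>) !! Suc k) else 0) \<partial>stream_space (step_space L) \<partial>step_space L)"
    unfolding ctmc_space_def by (rule nn_integral_stream_space) measurable
  also have "\<dots> = (\<integral>\<^sup>+a.
      (killed L x ^^ k) (\<lambda>y. if y = x then 0 else \<integral>\<^sup>+a. c y a \<partial>step_space L) (fst a x) \<partial>step_space L)"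
    unfolding jump_chain_Stream snth_Stream
    using nn_integral_path_cost[OF assms] by (intro nn_integral_cong) (simp add: ctmc_space_def)
  finally show ?thesis by (subst (asm) nn_integral_successor)
qed

section \<open>Return times and drift conditions\<close>

lemma jump_time_mono: "m \<le> n \<Longrightarrow> jump_time L x \<omega> m \<le> jump_time L x \<omega> n"
  unfolding jump_time_def by (intro sum_mono2) auto

text \<open>The intervals between consecutive jump times are disjoint by monotonicity, so the index
  described by \<open>THE\<close> is unique.\<close>

lemma ctmc_eq_SomeI:
  assumes "jump_time L x \<omega> n \<le> ennreal t" "ennreal t < jump_time L x \<omega> (Suc n)"
  shows "ctmc L x t \<omega> = Some (jump_chain x \<omega> n)"
proof -
  have "m = n" if m: "jump_time L x \<omega> m \<le> ennreal t" "ennreal t < jump_time L x \<omega> (Suc m)" for m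
  proof (rule ccontr)
    assume "m \<noteq> n"
    then consider "Suc m \<le> n" | "Suc n \<le> m" by linarith
    then show False
    proof cases
      case 1
      then show False using m(2) assms(1) jump_time_mono[OF 1, of L x \<omega>] by (meson leD order_trans)
    next
      case 2
      then show False using m(1) assms(2) jump_time_mono[OF 2, of L x \<omega>] by (meson leD order_trans)
    qed
  qed
  with assms have "(THE n. jump_time L x \<omega> n \<le> ennreal t \<and> ennreal t < jump_time L x \<omega> (Suc n)) = n"
    by (intro the_equality) blast+
  then show ?thesis using assms unfolding ctmc_def by metis
qed

lemma ctmc_SomeD:
  assumes "ctmc L x t \<omega> = Some y"
  obtains n where "jump_time L x \<omega> n \<le> ennreal t" "ennreal t < jump_time L x \<omega> (Suc n)"
    "y = jump_chain x \<omega> n"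
proof -
  obtain n where n: "jump_time L x \<omega> n \<le> ennreal t" "ennreal t < jump_time L x \<omega> (Suc n)"
    using assms unfolding ctmc_def by (auto split: if_splits)
  then show thesis using that[OF n] ctmc_eq_SomeI[OF n] assms by simp
qed

text \<open>Time spent away from \<open>x\<close> between the first jump and the next visit to
  \<open>x\<close>. Writing it as an infinite sum of truncated terms makes it meaningful on paths
  that never return.\<close>

definition excursion_time ::
  "(('s \<Rightarrow> real) \<Rightarrow> 's \<Rightarrow> real) \<Rightarrow> 's \<Rightarrow> (('s \<Rightarrow> 's) \<times> real) stream \<Rightarrow> ennreal" where
  "excursion_time L x \<omega> =
     (\<Sum>k. if \<forall>j\<le>k. jump_chain x \<omega> (Suc j) \<noteq> x then holding_time L x \<omega> (Suc k) else 0)"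

lemma jump_time_first_return:
  assumes "jump_chain x \<omega> (Suc m) = x" "\<And>j. j < m \<Longrightarrow> jump_chain x \<omega> (Suc j) \<noteq> x"
  shows "jump_time L x \<omega> (Suc m) = holding_time L x \<omega> 0 + excursion_time L x \<omega>"
proof -
  have iff: "(\<forall>j\<le>k. jump_chain x \<omega> (Suc j) \<noteq> x) \<longleftrightarrow> k < m" for k
    using assms by (metis le_less_trans linorder_not_less)
  have "excursion_time L x \<omega> = (\<Sum>k<m. if k < m then holding_time L x \<omega> (Suc k) else 0)"
    unfolding excursion_time_def iff by (intro suminf_finite) auto
  also have "\<dots> = (\<Sum>k<m. holding_time L x \<omega> (Suc k))" by simp
  finally show ?thesis unfolding jump_time_def by (simp only: sum.lessThan_Suc_shift)
qed

lemma first_return_exists: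
  assumes "jump_chain x \<omega> (Suc n) = x"
  obtains m where "m \<le> n" "jump_chain x \<omega> (Suc m) = x" "\<And>j. j < m \<Longrightarrow> jump_chain x \<omega> (Suc j) \<noteq> x"
proof
  let ?P = "\<lambda>m. jump_chain x \<omega> (Suc m) = x"
  show "Least ?P \<le> n" by (rule Least_le[where P="?P", OF assms])
  show "jump_chain x \<omega> (Suc (Least ?P)) = x" by (rule LeastI[where P="?P", OF assms])
  show "jump_chain x \<omega> (Suc j) \<noteq> x" if "j < Least ?P" for j
    using not_less_Least[OF that] .
qed

lemma return_time_le:
  assumes pos: "\<And>n. 0 < snd (\<omega> !! n)" and rate: "\<And>y. 0 < exit_rate L y"
    and ret: "jump_chain x \<omega> (Suc n) = x"
  shows "return_time L x \<omega> \<le> holding_time L x \<omega> 0 + excursion_time L x \<omega>"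
proof -
  obtain m where m: "jump_chain x \<omega> (Suc m) = x" "\<And>j. j < m \<Longrightarrow> jump_chain x \<omega> (Suc j) \<noteq> x"
    using first_return_exists[OF ret] by metis
  have hold: "holding_time L x \<omega> k = ennreal (snd (\<omega> !! k) / exit_rate L (jump_chain x \<omega> k))" for k
    unfolding holding_time_def using pos[of k] rate by (simp add: divide_ennreal less_imp_le)
  have jt: "jump_time L x \<omega> k = ennreal (\<Sum>i<k. snd (\<omega> !! i) / exit_rate L (jump_chain x \<omega> i))" for k
    unfolding jump_time_def hold using pos rate
    by (intro sum_ennreal) (simp add: less_imp_le)
  let ?t = "\<Sum>i<Suc m. snd (\<omega> !! i) / exit_rate L (jump_chain x \<omega> i)"
  have t0: "0 \<le> ?t" using pos rate by (intro sum_nonneg) (simp add: less_imp_le)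
  \<comment> \<open>The next holding time is strictly positive, so the half-open interval starting
    at \<open>?t\<close> is nonempty and the chain really is in \<open>x\<close> at time
    \<open>?t\<close>.\<close>
  have "ennreal ?t < jump_time L x \<omega> (Suc (Suc m))"
    unfolding jt using t0 pos[of "Suc m"] rate[of "jump_chain x \<omega> (Suc m)"]
    by (subst ennreal_less_iff) (auto simp del: jump_chain.simps)
  then have "ctmc L x ?t \<omega> = Some x"
    using ctmc_eq_SomeI[of L x \<omega> "Suc m" ?t] m(1) jt[of "Suc m"] by simp
  moreover have "jump_time L x \<omega> 1 \<le> ennreal ?t"
    unfolding jt[of "Suc m", symmetric] by (rule jump_time_mono) simp
  ultimately have "return_time L x \<omega> \<le> ennreal ?t"
    unfolding return_time_def using t0 by (intro INF_lower) auto
  then show ?thesis using jump_time_first_return[OF m] jt[of "Suc m"] by metis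
qed

text \<open>A time counted in the infimum lies in the holding interval of some visit to
  \<open>x\<close> after the first jump, hence not before the first such visit. If there is no such
  visit, the infimum is over the empty set and equals infinity.\<close>

lemma excursion_time_le_return_time: "excursion_time L x \<omega> \<le> return_time L x \<omega>"
  and return_time_eq_top: "(\<And>n. jump_chain x \<omega> (Suc n) \<noteq> x) \<Longrightarrow> return_time L x \<omega> = \<infinity>"
proof -
  have *: "\<exists>n. jump_chain x \<omega> (Suc n) = x \<and> excursion_time L x \<omega> \<le> ennreal t"
    if t: "jump_time L x \<omega> 1 \<le> ennreal t" "ctmc L x t \<omega> = Some x" for t
  proof -
    obtain n where n: "jump_time L x \<omega> n \<le> ennreal t" "ennreal t < jump_time L x \<omega> (Suc n)"
      "x = jump_chain x \<omega> n"
      by (rule ctmc_SomeD[OF t(2)])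
    \<comment> \<open>A time at or after the first jump is outside the initial holding interval,
      which excludes the trivial visit at time 0.\<close>
    have "n \<noteq> 0" using n(2) t(1) by (metis One_nat_def leD)
    then obtain k where k: "n = Suc k" by (cases n) auto
    then obtain m where m: "m \<le> k" "jump_chain x \<omega> (Suc m) = x"
      "\<And>j. j < m \<Longrightarrow> jump_chain x \<omega> (Suc j) \<noteq> x"
      using first_return_exists[of x \<omega> k] n(3) by metis
    have "excursion_time L x \<omega> \<le> jump_time L x \<omega> (Suc m)"
      using jump_time_first_return[OF m(2,3), of L] by simp
    also have "\<dots> \<le> jump_time L x \<omega> n"
      using m(1) k by (intro jump_time_mono) simp
    finally show ?thesis using n(1) m(2) by (metis order_trans)
  qed
  show "excursion_time L x \<omega> \<le> return_time L x \<omega>"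
    unfolding return_time_def using * by (intro INF_greatest) auto
  assume "\<And>n. jump_chain x \<omega> (Suc n) \<noteq> x"
  then have empty: "{t. 0 \<le> t \<and> jump_time L x \<omega> 1 \<le> ennreal t \<and> ctmc L x t \<omega> = Some x} = {}"
    using * by blast
  show "return_time L x \<omega> = \<infinity>" unfolding return_time_def empty by simp
qed

section \<open>Foster's criterion\<close>

lemma suminf_one_ennreal: "(\<Sum>k::nat. 1 :: ennreal) = \<infinity>"
proof (rule ccontr)
  assume "(\<Sum>k::nat. 1 :: ennreal) \<noteq> \<infinity>"
  then obtain n where "(\<Sum>k::nat. 1 :: ennreal) < of_nat n"
    using ennreal_Ex_less_of_nat by (auto simp: less_top)
  moreover have "(\<Sum>k<n. 1 :: ennreal) \<le> (\<Sum>k::nat. 1 :: ennreal)"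
    by (rule sum_le_suminf) auto
  ultimately show False by simp
qed

lemma killed_sum: "finite A \<Longrightarrow> (\<Sum>k\<in>A. killed L x (h k) y) = killed L x (\<lambda>z. \<Sum>k\<in>A. h k z) y"
  unfolding killed_def by (auto simp: nn_integral_sum)

text \<open>Foster's argument: each partial sum is bounded by \<open>W\<close> through induction on
  its length, since the cost \<open>u y\<close> of one step is paid by the mean decrease of
  \<open>W\<close>. At \<open>x\<close> the cost and the killed operator both vanish, so no drift is
  required there.\<close>

lemma suminf_killed_le:
  fixes W :: "'s \<Rightarrow> ennreal"
  assumes closed: "\<And>y. y \<in> S \<Longrightarrow> set_pmf (jump_kernel L y) \<subseteq> S"
    and drift: "\<And>y. y \<in> S \<Longrightarrow> y \<noteq> x \<Longrightarrow> u y + (\<integral>\<^sup>+z. W z \<partial>measure_pmf (jump_kernel L y)) \<le> W y"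
    and ux: "u x = 0" and y: "y \<in> S"
  shows "(\<Sum>k. (killed L x ^^ k) u y) \<le> W y"
proof -
  have "(\<Sum>k<n. (killed L x ^^ k) u y) \<le> W y" if "y \<in> S" for n y
    using that
  proof (induction n arbitrary: y)
    case 0
    then show ?case by simp
  next
    case (Suc n)
    have "(\<Sum>k<Suc n. (killed L x ^^ k) u y) = u y + killed L x (\<lambda>z. \<Sum>k<n. (killed L x ^^ k) u z) y"
      by (subst sum.lessThan_Suc_shift) (simp add: killed_sum)
    also have "\<dots> \<le> W y"
    proof (cases "y = x")
      case True
      then show ?thesis using ux by (simp add: killed_def)
    next
      case False
      have "killed L x (\<lambda>z. \<Sum>k<n. (killed L x ^^ k) u z) y \<le> (\<integral>\<^sup>+z. W z \<partial>measure_pmf (jump_kernel L y))"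
        using False closed[OF Suc.prems] Suc.IH
        by (subst killed_def, simp, intro nn_integral_mono_AE) (auto simp: AE_measure_pmf_iff subset_iff)
      then show ?thesis
        using drift[OF Suc.prems False] by (meson add_left_mono order_trans)
    qed
    finally show ?case .
  qed
  then show ?thesis using y by (intro suminf_le_const summableI) auto
qed

lemma nn_integral_holding_rate:
  "(\<integral>\<^sup>+a. ennreal (snd a) / ennreal q \<partial>step_space L) = 1 / ennreal q"
  by (subst nn_integral_divide) (simp_all add: nn_integral_holding)

lemma measurable_holding_time:
  fixes L :: "(('s::countable \<Rightarrow> real) \<Rightarrow> 's \<Rightarrow> real)"
  shows "(\<lambda>\<omega>. holding_time L x \<omega> n) \<in> borel_measurable (ctmc_space L)"
  unfolding holding_time_def
  by (rule measurable_path_cost[where c="\<lambda>y a. ennreal (snd a) / ennreal (exit_rate L y)"]) measurable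

lemma measurable_excursion_time:
  fixes L :: "(('s::countable \<Rightarrow> real) \<Rightarrow> 's \<Rightarrow> real)"
  shows "excursion_time L x \<in> borel_measurable (ctmc_space L)"
proof -
  note measurable_holding_time[measurable]
  have "(\<lambda>\<omega>. \<Sum>k. if \<forall>j\<le>k. jump_chain x \<omega> (Suc j) \<noteq> x then holding_time L x \<omega> (Suc k) else 0)
    \<in> borel_measurable (ctmc_space L)"
    by (simp del: jump_chain.simps; measurable)
  then show ?thesis unfolding excursion_time_def[abs_def] .
qed

lemma nn_integral_holding_time_0:
  fixes L :: "(('s::countable \<Rightarrow> real) \<Rightarrow> 's \<Rightarrow> real)"
  shows "(\<integral>\<^sup>+\<omega>. holding_time L x \<omega> 0 \<partial>ctmc_space L) = 1 / ennreal (exit_rate L x)"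
proof -
  interpret prob_space "step_space L" by (rule prob_space_step_space)
  interpret S: prob_space "stream_space (step_space L)" by (rule prob_space_stream_space)
  have "(\<lambda>\<omega>. holding_time L x \<omega> 0) \<in> borel_measurable (stream_space (step_space L))"
    using measurable_holding_time[of L x 0] unfolding ctmc_space_def .
  then have "(\<integral>\<^sup>+\<omega>. holding_time L x \<omega> 0 \<partial>ctmc_space L)
     = (\<integral>\<^sup>+a. ennreal (snd a) / ennreal (exit_rate L x) \<partial>step_space L)"
    unfolding ctmc_space_def
    by (subst nn_integral_stream_space) (auto simp: S.emeasure_space_1 holding_time_def)
  then show ?thesis by (simp only: nn_integral_holding_rate)
qed

lemma nn_integral_excursion_cost_suminf:
  fixes L :: "(('s::countable \<Rightarrow> real) \<Rightarrow> 's \<Rightarrow> real)" and c :: "'s \<Rightarrow> ('s \<Rightarrow> 's) \<times> real \<Rightarrow> ennreal"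
  assumes [measurable]: "\<And>y. c y \<in> borel_measurable (step_space L)"
  shows "(\<integral>\<^sup>+\<omega>. (\<Sum>k. if \<forall>j\<le>k. jump_chain x \<omega> (Suc j) \<noteq> x
            then c (jump_chain x \<omega> (Suc k)) (\<omega> !! Suc k) else 0) \<partial>ctmc_space L)
     = (\<Sum>k. \<integral>\<^sup>+z. (killed L x ^^ k) (\<lambda>y. if y = x then 0 else \<integral>\<^sup>+a. c y a \<partial>step_space L) z
          \<partial>measure_pmf (jump_kernel L x))"
proof -
  have [measurable]: "(\<lambda>\<omega>. c (jump_chain x \<omega> k) (\<omega> !! k)) \<in> borel_measurable (ctmc_space L)" for k
    by measurable
  show ?thesis unfolding nn_integral_excursion_cost[OF assms, symmetric]
    by (rule nn_integral_suminf) (simp del: jump_chain.simps snth.simps; measurable)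
qed

text \<open>Given the state, a holding time has mean \<open>1 / exit_rate\<close>, so the
  continuous-time excursion is an additive cost along the jump chain.\<close>

lemma nn_integral_excursion_time:
  fixes L :: "(('s::countable \<Rightarrow> real) \<Rightarrow> 's \<Rightarrow> real)"
  shows "(\<integral>\<^sup>+\<omega>. excursion_time L x \<omega> \<partial>ctmc_space L) =
    (\<Sum>k. \<integral>\<^sup>+z. (killed L x ^^ k) (\<lambda>y. if y = x then 0 else 1 / ennreal (exit_rate L y)) z
        \<partial>measure_pmf (jump_kernel L x))"
  unfolding excursion_time_def holding_time_def nn_integral_holding_rate[where L=L, symmetric]
  by (rule nn_integral_excursion_cost_suminf) measurable

text \<open>\<open>W\<close> bounds the mean number of jumps needed to hit \<open>x\<close>.
  Finiteness after the first jump yields almost sure return, and with rates bounded below also a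
  finite mean excursion time.\<close>

theorem positive_recurrent_state_foster:
  fixes L :: "(('s::countable \<Rightarrow> real) \<Rightarrow> 's \<Rightarrow> real)" and W :: "'s \<Rightarrow> ennreal"
  assumes closed: "\<And>y. y \<in> S \<Longrightarrow> set_pmf (jump_kernel L y) \<subseteq> S"
    and x: "x \<in> S"
    and r: "0 < r" and rate: "\<And>y. r \<le> exit_rate L y"
    and drift: "\<And>y. y \<in> S \<Longrightarrow> y \<noteq> x \<Longrightarrow> 1 + (\<integral>\<^sup>+z. W z \<partial>measure_pmf (jump_kernel L y)) \<le> W y"
    and fin: "(\<integral>\<^sup>+z. W z \<partial>measure_pmf (jump_kernel L x)) < \<infinity>"
  shows "positive_recurrent_state L x"
proof -
  let ?J = "measure_pmf (jump_kernel L x)"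
  have inv_rate: "1 / ennreal (exit_rate L y) \<le> ennreal (1 / r)" for y
    using r rate[of y]
    by (subst ennreal_1[symmetric], subst divide_ennreal) (auto intro!: ennreal_leI divide_left_mono)
  \<comment> \<open>Scaling \<open>W\<close> by \<open>C\<close> bounds every cost of at most
    \<open>C\<close> per step. It is used with \<open>C = 1\<close> for the number of jumps and with
    \<open>C = 1 / r\<close> for the holding times.\<close>
  have bound: "(\<Sum>k. \<integral>\<^sup>+z. (killed L x ^^ k) u z \<partial>?J) \<le> C * (\<integral>\<^sup>+z. W z \<partial>?J)"
    if u: "u x = 0" "\<And>y. u y \<le> C" for u C
  proof -
    have "(\<Sum>k. \<integral>\<^sup>+z. (killed L x ^^ k) u z \<partial>?J) = (\<integral>\<^sup>+z. (\<Sum>k. (killed L x ^^ k) u z) \<partial>?J)"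
      by (rule nn_integral_suminf[symmetric]) simp
    also have "\<dots> \<le> (\<integral>\<^sup>+z. C * W z \<partial>?J)"
    proof (intro nn_integral_mono_AE, unfold AE_measure_pmf_iff, intro ballI)
      fix z assume "z \<in> set_pmf (jump_kernel L x)"
      then have "z \<in> S" using closed[OF x] by auto
      then show "(\<Sum>k. (killed L x ^^ k) u z) \<le> C * W z"
      proof (rule suminf_killed_le[OF closed, where u=u, rotated 3])
        fix y assume y: "y \<in> S" "y \<noteq> x"
        have "u y + (\<integral>\<^sup>+ z. C * W z \<partial>measure_pmf (jump_kernel L y))
          \<le> C * (1 + (\<integral>\<^sup>+ z. W z \<partial>measure_pmf (jump_kernel L y)))"
          using u(2) by (simp add: nn_integral_cmult distrib_left)
        also have "\<dots> \<le> C * W y" by (rule mult_left_mono[OF drift[OF y]]) simp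
        finally show "u y + (\<integral>\<^sup>+ z. C * W z \<partial>measure_pmf (jump_kernel L y)) \<le> C * W y" .
      qed (use u in auto)
    qed
    finally show ?thesis by (simp add: nn_integral_cmult)
  qed
  have "(\<integral>\<^sup>+\<omega>. (\<Sum>k. if \<forall>j\<le>k. jump_chain x \<omega> (Suc j) \<noteq> x then 1 else 0) \<partial>ctmc_space L)
     = (\<Sum>k. \<integral>\<^sup>+\<omega>. (if \<forall>j\<le>k. jump_chain x \<omega> (Suc j) \<noteq> x then 1 else 0) \<partial>ctmc_space L)"
    by (rule nn_integral_suminf) (simp del: jump_chain.simps snth.simps; measurable)
  also have "\<dots> = (\<Sum>k. \<integral>\<^sup>+z. (killed L x ^^ k) (\<lambda>y. if y = x then 0 else 1) z \<partial>?J)"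
    using nn_integral_excursion_cost[where c="\<lambda>_ _. 1" and L=L and x=x]
    by (simp add: prob_space.emeasure_space_1[OF prob_space_step_space] cong: if_cong)
  also have "\<dots> \<le> 1 * (\<integral>\<^sup>+z. W z \<partial>?J)" by (rule bound) auto
  also have "\<dots> < \<infinity>" using fin by simp
  finally have finN: "(\<integral>\<^sup>+\<omega>. (\<Sum>k. if \<forall>j\<le>k. jump_chain x \<omega> (Suc j) \<noteq> x then 1 else 0) \<partial>ctmc_space L) \<noteq> \<infinity>"
    by (simp only: less_top infinity_ennreal_def)
  have "(\<lambda>\<omega>. \<Sum>k. if \<forall>j\<le>k. jump_chain x \<omega> (Suc j) \<noteq> x then 1 else 0 :: ennreal)
      \<in> borel_measurable (ctmc_space L)"
    by (simp del: jump_chain.simps; measurable)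
  from nn_integral_noteq_infinite[OF this finN]
  have "AE \<omega> in ctmc_space L. return_time L x \<omega> \<le> holding_time L x \<omega> 0 + excursion_time L x \<omega>"
    using AE_holdings_pos
  proof eventually_elim
    case (elim \<omega>)
    \<comment> \<open>On a path without return every term of the jump count is 1, so the count would
      be infinite.\<close>
    have "\<exists>n. jump_chain x \<omega> (Suc n) = x"
    proof (rule ccontr)
      assume "\<nexists>n. jump_chain x \<omega> (Suc n) = x"
      then have "(\<Sum>k. if \<forall>j\<le>k. jump_chain x \<omega> (Suc j) \<noteq> x then 1 else 0 :: ennreal) = (\<Sum>k. 1)"
        by simp
      also have "\<dots> = \<infinity>" by (rule suminf_one_ennreal)
      finally show False using elim(1) by simp
    qed
    then show ?case using return_time_le[of \<omega> L x] elim(2) r rate by (metis less_le_trans)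
  qed
  then have "(\<integral>\<^sup>+\<omega>. return_time L x \<omega> \<partial>ctmc_space L)
      \<le> (\<integral>\<^sup>+\<omega>. holding_time L x \<omega> 0 + excursion_time L x \<omega> \<partial>ctmc_space L)"
    by (rule nn_integral_mono_AE)
  also have "\<dots> = (\<integral>\<^sup>+\<omega>. holding_time L x \<omega> 0 \<partial>ctmc_space L)
      + (\<integral>\<^sup>+\<omega>. excursion_time L x \<omega> \<partial>ctmc_space L)"
    by (rule nn_integral_add) (rule measurable_holding_time measurable_excursion_time)+
  also have "(\<integral>\<^sup>+\<omega>. holding_time L x \<omega> 0 \<partial>ctmc_space L) = 1 / ennreal (exit_rate L x)"
    by (rule nn_integral_holding_time_0)
  also have "1 / ennreal (exit_rate L x) \<le> ennreal (1 / r)"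
    by (rule inv_rate)
  also have "(\<integral>\<^sup>+\<omega>. excursion_time L x \<omega> \<partial>ctmc_space L) \<le> ennreal (1 / r) * (\<integral>\<^sup>+z. W z \<partial>?J)"
    unfolding nn_integral_excursion_time using inv_rate by (intro bound) auto
  also have "ennreal (1 / r) + ennreal (1 / r) * (\<integral>\<^sup>+z. W z \<partial>?J) < \<infinity>"
    using fin by (simp add: ennreal_mult_less_top)
  finally show ?thesis unfolding positive_recurrent_state_def by simp
qed

section \<open>Lyapunov criterion with a finite exceptional set\<close>

text \<open>Take \<open>\<psi> y = \<theta> ^ d y\<close>, where \<open>d\<close> is the distance to
  \<open>x\<close> inside \<open>C\<close> and \<open>\<theta>\<close> is half the least probability
  \<open>p\<close> of a chosen distance-decreasing step. That step alone contributes at least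
  \<open>p * \<theta> ^ (d y - 1) = 2 * \<psi> y\<close> to the mean, so the gain is at least
  \<open>\<psi> y\<close>, which is bounded below as \<open>C\<close> is finite.\<close>

lemma path_weight_exists:
  fixes K :: "'s \<Rightarrow> 's pmf"
  assumes C: "finite C"
    and reach: "\<And>y. y \<in> C \<Longrightarrow> (y, x) \<in> {(y, z). z \<in> C \<and> z \<in> set_pmf (K y)}\<^sup>*"
  obtains \<psi> \<kappa> where "0 < \<kappa>" "\<And>y. 0 \<le> \<psi> y" "\<And>y. \<psi> y \<le> (1::real)" "\<And>y. y \<notin> C \<Longrightarrow> \<psi> y = 0"
    "\<And>y. y \<in> C \<Longrightarrow> y \<noteq> x \<Longrightarrow> \<psi> y + \<kappa> \<le> measure_pmf.expectation (K y) \<psi>"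
proof -
  define r where "r = {(y, z). z \<in> C \<and> z \<in> set_pmf (K y)}"
  define d where "d y = (LEAST n. (y, x) \<in> r ^^ n)" for y
  have dI: "(y, x) \<in> r ^^ d y" if "y \<in> C" for y
  proof -
    have "\<exists>n. (y, x) \<in> r ^^ n" using reach[OF that] unfolding r_def by (rule rtrancl_imp_relpow)
    then show ?thesis unfolding d_def by (rule LeastI_ex)
  qed
  have "\<exists>z. z \<in> C \<and> z \<in> set_pmf (K y) \<and> Suc (d z) = d y" if y: "y \<in> C" "y \<noteq> x" for y
  proof -
    obtain n where n: "d y = Suc n" using dI[OF y(1)] y(2) by (cases "d y") auto
    then obtain z where z: "(y, z) \<in> r" "(z, x) \<in> r ^^ n"
      using dI[OF y(1)] by (metis relpow_Suc_D2)
    have "d z \<le> n" unfolding d_def by (rule Least_le[where P="\<lambda>n. (z, x) \<in> r ^^ n", OF z(2)])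
    moreover have "d y \<le> Suc (d z)"
    proof -
      have "z \<in> C" using z(1) by (simp add: r_def)
      then have "(y, x) \<in> r ^^ Suc (d z)" using z(1) dI by (metis relpow_Suc_I2)
      then show ?thesis unfolding d_def[of y] by (rule Least_le)
    qed
    ultimately show ?thesis using z(1) n by (intro exI[of _ z]) (auto simp: r_def)
  qed
  then obtain succ where succ: "succ y \<in> C" "succ y \<in> set_pmf (K y)" "Suc (d (succ y)) = d y"
    if "y \<in> C" "y \<noteq> x" for y by metis
  \<comment> \<open>Inserting 1 keeps the set nonempty when \<open>C\<close> has no point besides
    \<open>x\<close>, and also gives \<open>p \<le> 1\<close>.\<close>
  define p where "p = Min (insert 1 ((\<lambda>y. pmf (K y) (succ y)) ` (C - {x})))"
  have p0: "0 < p" unfolding p_def using C succ by (subst Min_gr_iff) (auto simp: pmf_positive)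
  have p1: "p \<le> 1" unfolding p_def using C by (intro Min_le) auto
  have p: "p \<le> pmf (K y) (succ y)" if "y \<in> C" "y \<noteq> x" for y
    unfolding p_def using C that by (intro Min_le) auto
  define \<theta> where "\<theta> = p / 2"
  have \<theta>: "0 < \<theta>" "\<theta> \<le> 1" using p0 p1 by (auto simp: \<theta>_def)
  define \<psi> where "\<psi> y = (if y \<in> C then \<theta> ^ d y else 0)" for y
  define D where "D = Max (insert 0 (d ` C))"
  have D: "d y \<le> D" if "y \<in> C" for y unfolding D_def using C that by (intro Max_ge) auto
  have \<psi>01: "0 \<le> \<psi> y" "\<psi> y \<le> 1" for y using \<theta> by (auto simp: \<psi>_def power_le_one)
  show thesis
  proof (rule that[of "\<theta> * \<theta> ^ D" \<psi>])
    show "0 < \<theta> * \<theta> ^ D" using \<theta> by simp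
    show "\<psi> y = 0" if "y \<notin> C" for y using that by (simp add: \<psi>_def)
    fix y assume y: "y \<in> C" "y \<noteq> x"
    let ?z = "succ y"
    have "p * \<theta> ^ d ?z \<le> pmf (K y) ?z * \<psi> ?z"
      using p[OF y] succ(1)[OF y] \<theta> by (simp add: \<psi>_def mult_right_mono)
    also have "\<dots> = measure_pmf.expectation (K y) (\<lambda>z. indicator {?z} z * \<psi> ?z)"
      by (simp add: measure_pmf_single)
    also have "\<dots> \<le> measure_pmf.expectation (K y) \<psi>"
    proof (rule integral_mono)
      show "integrable (measure_pmf (K y)) \<psi>"
        using \<psi>01 by (intro measure_pmf.integrable_const_bound[where B=1]) auto
      show "integrable (measure_pmf (K y)) (\<lambda>z. indicator {?z} z * \<psi> ?z)"
        using \<psi>01 by (intro measure_pmf.integrable_const_bound[where B=1]) (auto split: split_indicator)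
    qed (use \<psi>01 in \<open>auto split: split_indicator\<close>)
    finally have "p * \<theta> ^ d ?z \<le> measure_pmf.expectation (K y) \<psi>" .
    moreover have "\<psi> y = \<theta> * \<theta> ^ d ?z" using y succ(3)[OF y] by (simp add: \<psi>_def flip: power_Suc)
    moreover have "\<theta> * \<theta> ^ D \<le> \<theta> * \<theta> ^ d ?z"
      using \<theta> D[OF succ(1)[OF y]] by (intro mult_left_mono power_decreasing) auto
    moreover have "p = 2 * \<theta>" by (simp add: \<theta>_def)
    ultimately show "\<psi> y + \<theta> * \<theta> ^ D \<le> measure_pmf.expectation (K y) \<psi>" by simp
  qed (use \<psi>01 in auto)
qed

text \<open>\<open>V\<close> is corrected inside \<open>C\<close> by a multiple of the weight \<open>1 - \<psi>\<close> of \<open>path_weight_exists\<close>.\<close>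

theorem positive_recurrent_state_lyapunov:
  fixes L :: "(('s::countable \<Rightarrow> real) \<Rightarrow> 's \<Rightarrow> real)" and V :: "'s \<Rightarrow> real"
  assumes closed: "\<And>y. y \<in> S \<Longrightarrow> set_pmf (jump_kernel L y) \<subseteq> S"
    and fin: "\<And>y. y \<in> S \<Longrightarrow> finite (set_pmf (jump_kernel L y))"
    and x: "x \<in> S"
    and r: "0 < r" and rate: "\<And>y. r \<le> exit_rate L y"
    and V0: "\<And>y. 0 \<le> V y" and a: "0 < a"
    and C: "finite C" "C \<subseteq> S"
    and drift: "\<And>y. y \<in> S \<Longrightarrow> y \<notin> C \<Longrightarrow> measure_pmf.expectation (jump_kernel L y) V \<le> V y - a"
    and reach: "\<And>y. y \<in> C \<Longrightarrow> (y, x) \<in> {(y, z). z \<in> C \<and> z \<in> set_pmf (jump_kernel L y)}\<^sup>*"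
  shows "positive_recurrent_state L x"
proof -
  let ?E = "\<lambda>y. measure_pmf.expectation (jump_kernel L y)"
  obtain \<psi> \<kappa> where \<psi>: "0 < \<kappa>" "\<And>y. 0 \<le> \<psi> y" "\<And>y. \<psi> y \<le> (1::real)" "\<And>y. y \<notin> C \<Longrightarrow> \<psi> y = 0"
    "\<And>y. y \<in> C \<Longrightarrow> y \<noteq> x \<Longrightarrow> \<psi> y + \<kappa> \<le> ?E y \<psi>"
    by (rule path_weight_exists[OF C(1) reach]) blast+
  \<comment> \<open>The worst mean increase of \<open>V\<close> over the finite set
    \<open>C\<close>.\<close>
  define M where "M = Max (insert 0 ((\<lambda>y. ?E y V - V y) ` C))"
  have M: "?E y V \<le> V y + M" if "y \<in> C" for y
  proof -
    have "?E y V - V y \<le> M" unfolding M_def using C that by (intro Max_ge) auto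
    then show ?thesis by simp
  qed
  have M0: "0 \<le> M" unfolding M_def using C by (intro Max_ge) auto
  \<comment> \<open>Chosen so that \<open>B * \<kappa> = M / a + 1\<close>: inside \<open>C\<close>
    the gain \<open>\<kappa>\<close> of \<open>\<psi>\<close> offsets the increase of
    \<open>V / a\<close> and leaves a decrease of 1.\<close>
  define B where "B = (M / a + 1) / \<kappa>"
  have B: "0 \<le> B" "B * \<kappa> = M / a + 1" using \<psi>(1) M0 a by (auto simp: B_def)
  define W where "W y = V y / a + B * (1 - \<psi> y)" for y
  have W0: "0 \<le> W y" for y using V0 a B(1) \<psi>(3)[of y] by (simp add: W_def)
  have nn: "(\<integral>\<^sup>+z. ennreal (W z) \<partial>measure_pmf (jump_kernel L y)) = ennreal (?E y W)" if "y \<in> S" for y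
    using fin[OF that] W0 by (intro nn_integral_eq_integral integrable_measure_pmf_finite) auto
  have EW: "?E y W = ?E y V / a + B * (1 - ?E y \<psi>)" if "y \<in> S" for y
  proof -
    have "integrable (measure_pmf (jump_kernel L y)) f" for f :: "'s \<Rightarrow> real"
      by (rule integrable_measure_pmf_finite[OF fin[OF that]])
    then show ?thesis unfolding W_def by simp
  qed
  show ?thesis
  proof (rule positive_recurrent_state_foster[OF closed x r rate])
    fix y assume y: "y \<in> S" "y \<noteq> x"
    have "1 + ?E y W \<le> W y"
    proof (cases "y \<in> C")
      case True
      have "?E y V / a \<le> V y / a + M / a"
        using M[OF True] a by (simp add: divide_right_mono flip: add_divide_distrib)
      moreover have "B * (1 - ?E y \<psi>) \<le> B * (1 - \<psi> y - \<kappa>)"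
        using \<psi>(5)[OF True y(2)] B(1) by (intro mult_left_mono) auto
      moreover have "B * (1 - \<psi> y - \<kappa>) = B * (1 - \<psi> y) - (M / a + 1)"
        unfolding B(2)[symmetric] by (simp add: algebra_simps)
      ultimately show ?thesis unfolding EW[OF y(1)] W_def by simp
    next
      case False
      \<comment> \<open>Outside \<open>C\<close> the drift of \<open>V / a\<close> already gives the
        unit decrease. As \<open>\<psi>\<close> is 0 at \<open>y\<close> and nonnegative elsewhere,
        the correction term cannot increase in mean.\<close>
      have "?E y V / a \<le> V y / a - 1"
        using drift[OF y(1) False] a by (simp add: field_simps)
      moreover have "0 \<le> ?E y \<psi>" using \<psi>(2) by simp
      then have "B * (1 - ?E y \<psi>) \<le> B * (1 - \<psi> y)"
        using \<psi>(4)[OF False] B(1) by (intro mult_left_mono) auto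
      ultimately show ?thesis unfolding EW[OF y(1)] W_def by simp
    qed
    then show "1 + (\<integral>\<^sup>+z. ennreal (W z) \<partial>measure_pmf (jump_kernel L y)) \<le> ennreal (W y)"
      unfolding nn[OF y(1)] using W0
      by (simp add: ennreal_leI flip: ennreal_1 ennreal_plus)
  qed (simp_all add: nn[OF x])
qed

section \<open>Submartingale criterion against positive recurrence\<close>

lemma AE_successor:
  fixes L :: "(('s::countable \<Rightarrow> real) \<Rightarrow> 's \<Rightarrow> real)"
  shows "AE \<omega> in ctmc_space L. \<forall>n y. fst (\<omega> !! n) y \<in> set_pmf (jump_kernel L y)"
proof -
  interpret prob_space "step_space L" by (rule prob_space_step_space)
  have *: "AE a in step_space L. fst a y \<in> set_pmf (jump_kernel L y)" for y
  proof -
    have "(\<integral>\<^sup>+a. indicator (- set_pmf (jump_kernel L y)) (fst a y) \<partial>step_space L) = 0"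
      by (subst nn_integral_successor)
        (simp add: emeasure_Int_set_pmf[of _ "- set_pmf (jump_kernel L y)", symmetric])
    then show ?thesis
      by (subst (asm) nn_integral_0_iff_AE) (auto elim: eventually_mono split: split_indicator_asm)
  qed
  have "AE \<omega> in stream_space (step_space L). stream_all (\<lambda>a. \<forall>y. fst a y \<in> set_pmf (jump_kernel L y)) \<omega>"
    by (rule AE_stream_all) (auto simp: AE_all_countable *)
  then show ?thesis unfolding ctmc_space_def stream_all_def .
qed

lemma killed_cmult: "killed L x (\<lambda>z. C * h z) y = C * killed L x h y"
  unfolding killed_def by (simp add: nn_integral_cmult)

lemma killed_mono:
  assumes "\<And>z. z \<in> set_pmf (jump_kernel L y) \<Longrightarrow> u z \<le> v z"
  shows "killed L x u y \<le> killed L x v y"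
  unfolding killed_def using assms by (auto intro!: nn_integral_mono_AE simp: AE_measure_pmf_iff)

lemma killed_funpow_le_cmult:
  assumes closed: "\<And>y. y \<in> S \<Longrightarrow> set_pmf (jump_kernel L y) \<subseteq> S"
    and le: "\<And>y. y \<in> S \<Longrightarrow> u y \<le> C * v y"
  shows "y \<in> S \<Longrightarrow> (killed L x ^^ k) u y \<le> C * (killed L x ^^ k) v y"
proof (induction k arbitrary: y)
  case (Suc k)
  have "killed L x ((killed L x ^^ k) u) y \<le> killed L x (\<lambda>z. C * (killed L x ^^ k) v z) y"
    using Suc closed by (intro killed_mono) auto
  then show ?case by (simp add: killed_cmult)
qed (use le in simp)

text \<open>The one-step submartingale inequality propagates through the iterates because
  \<open>killed\<close> is monotone.\<close>

lemma killed_funpow_ge: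
  assumes closed: "\<And>y. y \<in> S \<Longrightarrow> set_pmf (jump_kernel L y) \<subseteq> S"
    and le: "\<And>y. y \<in> S \<Longrightarrow> u y \<le> killed L x u y"
  shows "y \<in> S \<Longrightarrow> u y \<le> (killed L x ^^ k) u y"
proof (induction k arbitrary: y)
  case (Suc k)
  have "u y \<le> killed L x u y" using le[OF Suc.prems] .
  also have "\<dots> \<le> killed L x ((killed L x ^^ k) u) y"
    using Suc closed by (intro killed_mono) auto
  finally show ?case by simp
qed simp

text \<open>The hypothesis \<open>down\<close> compares the probability of a downward step with
  \<open>C\<close> times the mean holding time, so the mean number of such steps per excursion is at
  most \<open>C\<close> times the mean return time. By \<open>lip\<close> each of them lowers
  \<open>g\<close> by at most 1, and \<open>start\<close> makes the initial mean of \<open>g\<close>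
  positive.\<close>

theorem not_positive_recurrent_state_submartingale:
  fixes L :: "(('s::countable \<Rightarrow> real) \<Rightarrow> 's \<Rightarrow> real)" and g :: "'s \<Rightarrow> real"
  assumes closed: "\<And>y. y \<in> S \<Longrightarrow> set_pmf (jump_kernel L y) \<subseteq> S"
    and x: "x \<in> S" and rate: "0 < exit_rate L x"
    and g0: "\<And>y. 0 \<le> g y" and gx: "g x = 0"
    and sub: "\<And>y. y \<in> S \<Longrightarrow> y \<noteq> x \<Longrightarrow> ennreal (g y) \<le> (\<integral>\<^sup>+z. ennreal (g z) \<partial>measure_pmf (jump_kernel L y))"
    and start: "0 < (\<integral>\<^sup>+z. ennreal (g z) \<partial>measure_pmf (jump_kernel L x))"
    and lip: "\<And>y z. y \<in> S \<Longrightarrow> z \<in> set_pmf (jump_kernel L y) \<Longrightarrow> g y \<le> g z + 1"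
    and down: "\<And>y. y \<in> S \<Longrightarrow> emeasure (measure_pmf (jump_kernel L y)) {z. g z < g y}
        \<le> ennreal C * (1 / ennreal (exit_rate L y))"
  shows "\<not> positive_recurrent_state L x"
proof
  assume "positive_recurrent_state L x"
  then have fin: "(\<integral>\<^sup>+\<omega>. return_time L x \<omega> \<partial>ctmc_space L) < \<infinity>"
    using rate unfolding positive_recurrent_state_def by auto
  define J where "J = measure_pmf (jump_kernel L x)"
  define A where "A \<omega> k \<longleftrightarrow> (\<forall>j\<le>k. jump_chain x \<omega> (Suc j) \<noteq> x)" for \<omega> :: "(('s \<Rightarrow> 's) \<times> real) stream" and k
  define c where "c y a = (indicator {z. g z < g y} (fst a y) :: ennreal)" for y and a :: "('s \<Rightarrow> 's) \<times> real"
  \<comment> \<open>\<open>D\<close> marks a downward step of \<open>g\<close> out of the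
    \<open>k\<close>-th excursion state, the one reached by jump \<open>k + 1\<close>;
    \<open>G\<close> is the value of \<open>g\<close> in that state. Both are 0 once
    \<open>x\<close> has been revisited.\<close>
  define D where "D \<omega> k = (if A \<omega> k then c (jump_chain x \<omega> (Suc k)) (\<omega> !! Suc k) else 0)" for \<omega> k
  define G where "G \<omega> k = (if A \<omega> k then ennreal (g (jump_chain x \<omega> (Suc k))) else 0)" for \<omega> k
  define b where "b k = (\<integral>\<^sup>+\<omega>. D \<omega> k \<partial>ctmc_space L)" for k
  have c_meas [measurable]: "c y \<in> borel_measurable (step_space L)" for y
    unfolding c_def by (rule measurable_compose[OF measurable_successor]) simp
  have [measurable]: "(\<lambda>\<omega>. A \<omega> k) \<in> ctmc_space L \<rightarrow>\<^sub>M count_space UNIV" for k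
    unfolding A_def by (simp del: jump_chain.simps; measurable)
  have [measurable]: "(\<lambda>\<omega>. c (jump_chain x \<omega> k) (\<omega> !! k)) \<in> borel_measurable (ctmc_space L)" for k
    by measurable
  have D_meas [measurable]: "(\<lambda>\<omega>. D \<omega> k) \<in> borel_measurable (ctmc_space L)" for k
    unfolding D_def by (simp del: jump_chain.simps snth.simps; measurable)
  have G_meas [measurable]: "(\<lambda>\<omega>. G \<omega> k) \<in> borel_measurable (ctmc_space L)" for k
    unfolding G_def by (simp del: jump_chain.simps; measurable)
  have sumb: "(\<integral>\<^sup>+\<omega>. (\<Sum>k. D \<omega> k) \<partial>ctmc_space L) = (\<Sum>k. b k)"
    unfolding b_def by (rule nn_integral_suminf) simp
  have c_int: "(\<integral>\<^sup>+a. c y a \<partial>step_space L) = emeasure (measure_pmf (jump_kernel L y)) {z. g z < g y}" for y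
    unfolding c_def by (subst nn_integral_successor) simp

  \<comment> \<open>The return time is infinite on paths that never return, so its finite mean
    forces a return almost surely.\<close>
  have "AE \<omega> in ctmc_space L. (if \<exists>n. jump_chain x \<omega> (Suc n) = x then 0 else \<infinity> :: ennreal) \<noteq> \<infinity>"
  proof (rule nn_integral_noteq_infinite)
    show "(\<lambda>\<omega>. if \<exists>n. jump_chain x \<omega> (Suc n) = x then 0 else \<infinity> :: ennreal) \<in> borel_measurable (ctmc_space L)"
      by (simp del: jump_chain.simps; measurable)
    have "(\<integral>\<^sup>+\<omega>. (if \<exists>n. jump_chain x \<omega> (Suc n) = x then 0 else \<infinity> :: ennreal) \<partial>ctmc_space L)
       \<le> (\<integral>\<^sup>+\<omega>. return_time L x \<omega> \<partial>ctmc_space L)"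
      by (intro nn_integral_mono) (auto simp: return_time_eq_top simp del: jump_chain.simps)
    then show "(\<integral>\<^sup>+\<omega>. (if \<exists>n. jump_chain x \<omega> (Suc n) = x then 0 else \<infinity> :: ennreal) \<partial>ctmc_space L) \<noteq> \<infinity>"
      using fin by (auto simp: top_unique)
  qed
  \<comment> \<open>If the excursion is still running at index \<open>n\<close>, the current value
    of \<open>g\<close> must be worked off by later downward steps before the return, so it is at
    most their number.\<close>
  then have path: "AE \<omega> in ctmc_space L. (\<Sum>k<n. D \<omega> k) + G \<omega> n \<le> (\<Sum>k. D \<omega> k)" for n
    using AE_successor
  proof eventually_elim
    case (elim \<omega>)
    define y where "y k = jump_chain x \<omega> (Suc k)" for k
    have y_succ: "y (Suc k) = fst (\<omega> !! Suc k) (y k)" for k by (simp add: y_def)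
    have yS: "y k \<in> S" for k
    proof (induction k)
      case 0
      show ?case using elim(2) closed[OF x] unfolding y_def jump_chain.simps by blast
    next
      case (Suc k)
      then show ?case using elim(2) closed y_succ by (metis subsetD)
    qed
    obtain n' where "jump_chain x \<omega> (Suc n') = x" using elim(1) by (auto split: if_splits)
    then obtain m where m: "y m = x" "\<And>j. j < m \<Longrightarrow> y j \<noteq> x"
      using first_return_exists unfolding y_def by metis
    have A: "A \<omega> k \<longleftrightarrow> k < m" for k
      unfolding A_def y_def[symmetric] using m by (metis le_less_trans linorder_not_less)
    have step: "ennreal (g (y k)) \<le> c (y k) (\<omega> !! Suc k) + ennreal (g (y (Suc k)))" for k
    proof (cases "g (y (Suc k)) < g (y k)")
      case True
      have "y (Suc k) \<in> set_pmf (jump_kernel L (y k))" unfolding y_succ using elim(2) by blast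
      then have "g (y k) \<le> 1 + g (y (Suc k))" using lip[OF yS[of k]] by force
      then have "ennreal (g (y k)) \<le> 1 + ennreal (g (y (Suc k)))"
        using g0 by (metis ennreal_1 ennreal_leI ennreal_plus zero_le_one)
      then show ?thesis using True by (simp add: c_def y_succ)
    next
      case False
      then show ?thesis by (simp add: ennreal_leI add_increasing)
    qed
    \<comment> \<open>Backward induction from the return index \<open>m\<close>, where
      \<open>g\<close> vanishes; \<open>k\<close> counts the steps back.\<close>
    have tele: "ennreal (g (y (m - k))) \<le> (\<Sum>i=m-k..<m. c (y i) (\<omega> !! Suc i))" if "k \<le> m" for k
      using that
    proof (induction k)
      case 0
      then show ?case using m(1) gx by simp
    next
      case (Suc k)
      have eq: "m - k = Suc (m - Suc k)" using Suc.prems by simp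
      have "ennreal (g (y (m - Suc k))) \<le> c (y (m - Suc k)) (\<omega> !! Suc (m - Suc k)) + ennreal (g (y (m - k)))"
        using step[of "m - Suc k"] unfolding eq .
      also have "\<dots> \<le> c (y (m - Suc k)) (\<omega> !! Suc (m - Suc k)) + (\<Sum>i=m-k..<m. c (y i) (\<omega> !! Suc i))"
        using Suc by (intro add_left_mono) auto
      also have "\<dots> = (\<Sum>i=m-Suc k..<m. c (y i) (\<omega> !! Suc i))"
        using Suc.prems unfolding eq by (subst (2) sum.atLeast_Suc_lessThan) auto
      finally show ?case .
    qed
    show ?case
    proof (cases "n < m")
      case True
      have "ennreal (g (y n)) \<le> (\<Sum>i=n..<m. c (y i) (\<omega> !! Suc i))"
        using tele[of "m - n"] True by simp
      also have "\<dots> = (\<Sum>i=n..<m. D \<omega> i)" by (intro sum.cong) (auto simp: D_def A y_def)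
      finally have "(\<Sum>k<n. D \<omega> k) + G \<omega> n \<le> (\<Sum>k<n. D \<omega> k) + (\<Sum>i=n..<m. D \<omega> i)"
        using True by (intro add_left_mono) (simp add: G_def A y_def)
      also have "\<dots> = (\<Sum>k<m. D \<omega> k)"
        using True by (simp add: lessThan_atLeast0 sum.atLeastLessThan_concat)
      also have "\<dots> \<le> (\<Sum>k. D \<omega> k)" by (rule sum_le_suminf) auto
      finally show ?thesis .
    next
      case False
      then have "(\<Sum>k<n. D \<omega> k) + G \<omega> n = (\<Sum>k<n. D \<omega> k)" by (simp add: G_def A)
      also have "\<dots> \<le> (\<Sum>k. D \<omega> k)" by (rule sum_le_suminf) auto
      finally show ?thesis .
    qed
  qed
  have ineq: "(\<Sum>k<n. b k) + (\<integral>\<^sup>+\<omega>. G \<omega> n \<partial>ctmc_space L) \<le> (\<Sum>k. b k)" for n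
  proof -
    have "(\<Sum>k<n. b k) + (\<integral>\<^sup>+\<omega>. G \<omega> n \<partial>ctmc_space L) = (\<integral>\<^sup>+\<omega>. (\<Sum>k<n. D \<omega> k) + G \<omega> n \<partial>ctmc_space L)"
      unfolding b_def by (subst nn_integral_add) (simp_all add: nn_integral_sum)
    also have "\<dots> \<le> (\<integral>\<^sup>+\<omega>. (\<Sum>k. D \<omega> k) \<partial>ctmc_space L)"
      by (rule nn_integral_mono_AE[OF path])
    finally show ?thesis unfolding sumb .
  qed
  define u where "u y = (if y = x then 0 else ennreal (g y))" for y
  have u: "u = (\<lambda>y. ennreal (g y))" using gx by (auto simp: u_def fun_eq_iff)
  define s where "s = (\<integral>\<^sup>+z. u z \<partial>J)"
  \<comment> \<open>Since \<open>g x = 0\<close>, killing at \<open>x\<close> loses none of the mass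
    of \<open>g\<close>, and the submartingale property bounds the mean below by its value
    \<open>s\<close> after the first jump.\<close>
  have G_ge: "s \<le> (\<integral>\<^sup>+\<omega>. G \<omega> n \<partial>ctmc_space L)" for n
  proof -
    have "(\<integral>\<^sup>+\<omega>. G \<omega> n \<partial>ctmc_space L) = (\<integral>\<^sup>+z. (killed L x ^^ n) u z \<partial>J)"
      using nn_integral_excursion_cost[where c="\<lambda>y a. ennreal (g y)" and L=L and x=x and k=n]
      unfolding G_def A_def J_def u_def
      by (simp add: prob_space.emeasure_space_1[OF prob_space_step_space] cong: if_cong)
    also have "s \<le> \<dots>"
    proof -
      have "u y \<le> (killed L x ^^ n) u y" if "y \<in> S" for y
      proof (rule killed_funpow_ge[OF closed _ that])
        fix y assume "y \<in> S"
        then show "u y \<le> killed L x u y"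
          using sub[of y] by (cases "y = x") (auto simp: killed_def u gx)
      qed
      then show ?thesis unfolding s_def J_def
        using closed[OF x] by (intro nn_integral_mono_AE) (auto simp: AE_measure_pmf_iff subset_iff)
    qed
    finally show ?thesis .
  qed
  \<comment> \<open>The mean number of downward steps is compared termwise with the mean excursion
    time, which is finite by assumption.\<close>
  have "(\<Sum>k. b k) = (\<Sum>k. \<integral>\<^sup>+z. (killed L x ^^ k)
      (\<lambda>y. if y = x then 0 else emeasure (measure_pmf (jump_kernel L y)) {z. g z < g y}) z \<partial>J)"
    unfolding sumb[symmetric] D_def A_def J_def c_int[symmetric]
    by (rule nn_integral_excursion_cost_suminf[OF c_meas])
  also have "\<dots> \<le> (\<Sum>k. \<integral>\<^sup>+z. ennreal C * (killed L x ^^ k)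
      (\<lambda>y. if y = x then 0 else 1 / ennreal (exit_rate L y)) z \<partial>J)"
  proof (intro suminf_le summableI nn_integral_mono_AE, unfold J_def AE_measure_pmf_iff, intro ballI)
    fix k z assume "z \<in> set_pmf (jump_kernel L x)"
    then have "z \<in> S" using closed[OF x] by auto
    then show "(killed L x ^^ k) (\<lambda>y. if y = x then 0 else emeasure (measure_pmf (jump_kernel L y)) {z. g z < g y}) z
      \<le> ennreal C * (killed L x ^^ k) (\<lambda>y. if y = x then 0 else 1 / ennreal (exit_rate L y)) z"
      using down by (intro killed_funpow_le_cmult[OF closed]) auto
  qed
  also have "\<dots> = ennreal C * (\<integral>\<^sup>+\<omega>. excursion_time L x \<omega> \<partial>ctmc_space L)"
    unfolding nn_integral_excursion_time J_def by (simp add: nn_integral_cmult)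
  also have "\<dots> \<le> ennreal C * (\<integral>\<^sup>+\<omega>. return_time L x \<omega> \<partial>ctmc_space L)"
    by (intro mult_left_mono nn_integral_mono excursion_time_le_return_time) simp
  also have "\<dots> < \<infinity>" using fin by (simp add: ennreal_mult_less_top)
  finally have bfin: "(\<Sum>k. b k) < \<infinity>" .
  have le: "(\<Sum>k<n. b k) + s \<le> (\<Sum>k. b k)" for n
    using ineq[of n] G_ge[of n] by (meson add_left_mono order_trans)
  have sfin: "s < \<infinity>" using le[of 0] bfin by simp
  \<comment> \<open>Every partial sum stays below the total by at least \<open>s\<close>, hence so
    does the limit. This is impossible for a finite total and \<open>s > 0\<close>.\<close>
  have "(\<Sum>k. b k) \<le> (\<Sum>k. b k) - s"
    using le sfin by (intro suminf_le_const summableI) (simp add: ennreal_le_minus_iff less_top)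
  moreover have "s > 0" using start unfolding s_def J_def u .
  moreover have "s \<le> (\<Sum>k. b k)" using le[of 0] by simp
  ultimately show False using bfin sfin
    by (metis diff_gt_0_iff_gt_ennreal ennreal_between infinity_ennreal_def leD less_le_trans top.not_eq_extremum)
qed

section \<open>Matching probabilities\<close>

locale max_weight =
  fixes E :: "('v::finite \<times> 'v) set"
    and w :: "'v \<times> 'v \<Rightarrow> real"
    and F :: "'v \<times> 'v \<Rightarrow> real \<Rightarrow> real"
    and lam \<gamma> :: "'v \<Rightarrow> real"
  assumes sym: "sym E"
    and irrefl: "irrefl E"
    and gamma_nonneg: "\<And>i. 0 \<le> \<gamma> i"
    and F_cdf: "\<And>e. e \<in> E \<Longrightarrow> is_cdf (F e)"
    and lam_pos: "\<And>i. 0 < lam i"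
begin

abbreviation "L \<equiv> mw_generator E w F lam \<gamma>"
abbreviation "\<nu> \<equiv> match_prob E w F"
abbreviation "blocked x \<equiv> neighbours E (supp x)"

lemma edge_sym: "(i, j) \<in> E \<longleftrightarrow> (j, i) \<in> E"
  using sym by (auto dest: symD)

lemma in_neighbours_singleton: "i \<in> neighbours E {j} \<longleftrightarrow> (j, i) \<in> E"
  by (auto simp: neighbours_def edge_sym)

section \<open>Law of the errors and the random choice of a match\<close>

lemma prob_space_interval_measure: "e \<in> E \<Longrightarrow> prob_space (interval_measure (F e))"
proof -
  assume "e \<in> E"
  then obtain M where M: "real_distribution M" "F e = cdf M"
    using F_cdf unfolding is_cdf_def by blast
  interpret real_distribution M by (rule M(1))
  show ?thesis unfolding M(2)
    by (intro real_distribution.axioms(1) real_distribution_interval_measure cdf_nondecreasing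
        cdf_is_right_cont cdf_lim_at_top_prob cdf_lim_at_bot)
qed

lemma prob_space_errors: "prob_space (errors E F)"
  unfolding errors_def by (intro prob_space_PiM prob_space_interval_measure)

lemma measurable_error [measurable]: "e \<in> E \<Longrightarrow> (\<lambda>u. u e) \<in> borel_measurable (errors E F)"
  unfolding errors_def
  using measurable_component_singleton[of e E "\<lambda>e. interval_measure (F e)"]
  by (simp cong: measurable_cong_sets)

definition candidates :: "('v \<Rightarrow> nat) \<Rightarrow> 'v \<Rightarrow> 'v set" where
  "candidates x j = {i \<in> neighbours E {j}. 0 < x i}"

lemma candidates_empty_iff: "candidates x j = {} \<longleftrightarrow> j \<notin> blocked x"
  by (auto simp: candidates_def neighbours_def supp_def edge_sym)

definition score :: "('v \<Rightarrow> nat) \<Rightarrow> 'v \<Rightarrow> ('v \<times> 'v \<Rightarrow> real) \<Rightarrow> 'v \<Rightarrow> real" where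
  "score x j u i = max 0 (real (x i) + u (j, i)) + w (j, i)"

lemma mw_argmax_iff:
  "i \<in> mw_argmax E w x j u \<longleftrightarrow> i \<in> candidates x j \<and> (\<forall>k\<in>candidates x j. score x j u k \<le> score x j u i)"
  by (auto simp: mw_argmax_def is_arg_max_def candidates_def score_def not_less)

lemma mw_argmax_nonempty: "candidates x j \<noteq> {} \<Longrightarrow> mw_argmax E w x j u \<noteq> {}"
proof -
  assume ne: "candidates x j \<noteq> {}"
  have fin: "finite (score x j u ` candidates x j)" by simp
  have "Max (score x j u ` candidates x j) \<in> score x j u ` candidates x j"
    by (rule Max_in[OF fin]) (use ne in simp)
  then obtain i where i: "i \<in> candidates x j"
    "Max (score x j u ` candidates x j) = score x j u i" by (rule imageE)
  then have "i \<in> mw_argmax E w x j u"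
    unfolding mw_argmax_iff i(2)[symmetric] using Max_ge[OF fin] by blast
  then show ?thesis by auto
qed

lemma measurable_score [measurable]:
  "i \<in> candidates x j \<Longrightarrow> (\<lambda>u. score x j u i) \<in> borel_measurable (errors E F)"
  unfolding score_def by (rule borel_measurable_add borel_measurable_max borel_measurable_const measurable_error)+
    (auto simp: candidates_def in_neighbours_singleton)

lemma measurable_mw_argmax [measurable]:
  "Measurable.pred (errors E F) (\<lambda>u. i \<in> mw_argmax E w x j u)"
proof (cases "i \<in> candidates x j")
  case True
  have "Measurable.pred (errors E F) (\<lambda>u. score x j u k \<le> score x j u i)" if "k \<in> candidates x j" for k
    unfolding pred_def by (rule borel_measurable_le[OF measurable_score[OF that] measurable_score[OF True]])
  then have "Measurable.pred (errors E F) (\<lambda>u. \<forall>k\<in>candidates x j. score x j u k \<le> score x j u i)"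
    by (intro pred_intros_finite) auto
  then show ?thesis unfolding mw_argmax_iff using True by simp
next
  case False
  then show ?thesis unfolding mw_argmax_iff by simp
qed

text \<open>The conditional matching probability given the errors \<open>u\<close>. Inequalities are
  proved for it at fixed \<open>u\<close> and then integrated.\<close>

definition share :: "('v \<Rightarrow> nat) \<Rightarrow> 'v \<Rightarrow> 'v \<Rightarrow> ('v \<times> 'v \<Rightarrow> real) \<Rightarrow> real" where
  "share x j i u = indicator (mw_argmax E w x j u) i / real (card (mw_argmax E w x j u))"

lemma measurable_share [measurable]: "share x j i \<in> borel_measurable (errors E F)"
proof -
  have ind: "indicator (mw_argmax E w x j u) i = (if i \<in> mw_argmax E w x j u then 1 else 0 :: real)" for i u
    by (auto split: split_indicator)
  have card: "real (card (mw_argmax E w x j u)) = (\<Sum>i\<in>UNIV. if i \<in> mw_argmax E w x j u then 1 else 0)" for u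
    by (simp add: sum.If_cases)
  show ?thesis unfolding share_def[abs_def] ind card by measurable
qed

lemma share_nonneg: "0 \<le> share x j i u"
  and share_le_1: "share x j i u \<le> 1"
proof -
  show "0 \<le> share x j i u" by (simp add: share_def)
  show "share x j i u \<le> 1"
  proof (cases "i \<in> mw_argmax E w x j u")
    case True
    then have "1 \<le> card (mw_argmax E w x j u)" by (metis One_nat_def Suc_leI card_gt_0_iff empty_iff finite)
    then show ?thesis using True by (simp add: share_def)
  qed (simp add: share_def)
qed

lemma integrable_share [simp]: "integrable (errors E F) (share x j i)"
proof -
  interpret prob_space "errors E F" by (rule prob_space_errors)
  show ?thesis by (rule integrable_const_bound[where B=1]) (simp_all add: share_nonneg share_le_1)
qed

lemma sum_share: "j \<in> blocked x \<Longrightarrow> (\<Sum>i\<in>UNIV. share x j i u) = 1"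
proof -
  assume "j \<in> blocked x"
  then have ne: "mw_argmax E w x j u \<noteq> {}" using candidates_empty_iff mw_argmax_nonempty by metis
  have "(\<Sum>i\<in>UNIV. share x j i u) = (\<Sum>i\<in>UNIV. indicator (mw_argmax E w x j u) i) / real (card (mw_argmax E w x j u))"
    unfolding share_def by (rule sum_divide_distrib[symmetric])
  then show ?thesis using ne by (simp add: indicator_def sum.If_cases)
qed

lemma match_prob_share: "\<nu> x j i = (\<integral>u. share x j i u \<partial>errors E F)"
  unfolding match_prob_def share_def ..

lemma match_prob_nonneg: "0 \<le> \<nu> x j i"
  unfolding match_prob_share by (rule integral_nonneg_AE) (simp add: share_nonneg)

lemma match_prob_eq_0: "i \<notin> candidates x j \<Longrightarrow> \<nu> x j i = 0"
  unfolding match_prob_share share_def by (simp add: mw_argmax_iff indicator_def)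

lemma sum_match_prob: "j \<in> blocked x \<Longrightarrow> (\<Sum>i\<in>UNIV. \<nu> x j i) = 1"
proof -
  interpret prob_space "errors E F" by (rule prob_space_errors)
  assume "j \<in> blocked x"
  then show ?thesis
    unfolding match_prob_share by (simp add: sum_share prob_space flip: Bochner_Integration.integral_sum)
qed

text \<open>With errors bounded by \<open>m\<close> and rewards by \<open>W\<close>, each relevant
  score differs from the queue length by at most \<open>m + W\<close>. A maximiser therefore has a
  queue at most \<open>2 * (m + W)\<close> shorter than that of any candidate \<open>k\<close>, and
  the shares average over maximisers.\<close>

lemma sum_share_weighted_ge:
  assumes "\<And>e. e \<in> E \<Longrightarrow> \<bar>u e\<bar> \<le> m" and "(j, k) \<in> E"
    and W: "\<And>e. \<bar>w e\<bar> \<le> W"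
  shows "real (x k) - 2 * (m + W) \<le> (\<Sum>i\<in>UNIV. share x j i u * real (x i))"
proof (cases "0 < x k")
  case False
  have "0 \<le> m" using assms(1)[OF assms(2)] by simp
  moreover have "0 \<le> W" using W[of "(j, k)"] by simp
  moreover have "0 \<le> (\<Sum>i\<in>UNIV. share x j i u * real (x i))" by (intro sum_nonneg) (simp add: share_nonneg)
  ultimately show ?thesis using False by simp
next
  case True
  then have k: "k \<in> candidates x j" using assms(2) by (simp add: candidates_def in_neighbours_singleton)
  then have j: "j \<in> blocked x" using candidates_empty_iff by blast
  have ge: "real (x k) - 2 * (m + W) \<le> real (x i)" if "i \<in> mw_argmax E w x j u" for i
  proof -
    have i: "(j, i) \<in> E" and le: "score x j u k \<le> score x j u i"
      using that k by (auto simp: mw_argmax_iff candidates_def in_neighbours_singleton)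
    show ?thesis using le assms(1)[OF i] assms(1)[OF assms(2)] W[of "(j, i)"] W[of "(j, k)"]
      unfolding score_def by (auto simp: max_def split: if_splits)
  qed
  have "real (x k) - 2 * (m + W) = (\<Sum>i\<in>UNIV. share x j i u * (real (x k) - 2 * (m + W)))"
    using sum_share[OF j] by (simp flip: sum_distrib_right)
  also have "\<dots> \<le> (\<Sum>i\<in>UNIV. share x j i u * real (x i))"
    using ge by (intro sum_mono) (auto simp: share_def indicator_def divide_right_mono)
  finally show ?thesis .
qed

text \<open>
  The errors may fail to be integrable; tightness of their joint law costs only an arbitrarily
  small proportion of the largest queue.
\<close>

lemma match_prob_weighted_ge:
  assumes \<epsilon>: "0 < \<epsilon>" "\<epsilon> < 1"
  obtains K where "0 \<le> K"
    "\<And>x j k. (j, k) \<in> E \<Longrightarrow> (1 - \<epsilon>) * real (x k) - K \<le> (\<Sum>i\<in>UNIV. \<nu> x j i * real (x i))"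
proof -
  interpret prob_space "errors E F" by (rule prob_space_errors)
  \<comment> \<open>These events increase to the whole space, because each realisation of the
    finitely many errors is bounded. Hence some \<open>A m\<close> has probability above
    \<open>1 - \<epsilon>\<close>.\<close>
  define A where "A m = {u \<in> space (errors E F). \<forall>e\<in>E. \<bar>u e\<bar> \<le> real m}" for m
  have A [measurable]: "A m \<in> sets (errors E F)" for m
    unfolding A_def by measurable
  have "(\<lambda>m. measure (errors E F) (A m)) \<longlonglongrightarrow> measure (errors E F) (\<Union>m. A m)"
    by (intro finite_Lim_measure_incseq) (force simp: A_def incseq_def)+
  also have "(\<Union>m. A m) = space (errors E F)"
  proof -
    have "\<exists>m. \<forall>e\<in>E. \<bar>u e\<bar> \<le> real m" for u :: "'v \<times> 'v \<Rightarrow> real"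
    proof -
      obtain m where m: "Max (insert 0 ((\<lambda>e. \<bar>u e\<bar>) ` E)) \<le> real m" using real_arch_simple by blast
      have "\<bar>u e\<bar> \<le> real m" if "e \<in> E" for e
        using m that by (meson Max_ge finite finite_imageI finite_insert imageI insertI2 order_trans)
      then show ?thesis by blast
    qed
    then show ?thesis by (auto simp: A_def)
  qed
  finally have "(\<lambda>m. measure (errors E F) (A m)) \<longlonglongrightarrow> 1" by (simp add: prob_space)
  then have "eventually (\<lambda>m. 1 - \<epsilon> < measure (errors E F) (A m)) sequentially"
    using \<epsilon>(1) by (intro order_tendstoD(1)) auto
  then obtain m where m: "1 - \<epsilon> < measure (errors E F) (A m)"
    by (auto simp: eventually_sequentially)
  define W where "W = Max (range (\<lambda>e. \<bar>w e\<bar>))"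
  have W: "\<bar>w e\<bar> \<le> W" for e unfolding W_def by (intro Max_ge) auto
  have W0: "0 \<le> W" using W abs_ge_zero order_trans by blast
  have A_int: "integrable (errors E F) (indicat_real (A m))"
    by (rule integrable_real_indicator[OF A]) (simp add: emeasure_eq_measure)
  show thesis
  proof
    show "0 \<le> 2 * (real m + W)" using W0 by simp
    fix x :: "'v \<Rightarrow> nat" and j k assume jk: "(j, k) \<in> E"
    let ?c = "real (x k) - 2 * (real m + W)"
    \<comment> \<open>Truncation at 0 makes the factor nonnegative, so that
      \<open>1 - \<epsilon>\<close> can be replaced by the larger probability of \<open>A m\<close>;
      off \<open>A m\<close> nonnegativity of the weighted sum suffices.\<close>
    have "(1 - \<epsilon>) * real (x k) - 2 * (real m + W) \<le> (1 - \<epsilon>) * max 0 ?c"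
    proof -
      have "(1 - \<epsilon>) * real (x k) - (1 - \<epsilon>) * (2 * (real m + W)) \<le> (1 - \<epsilon>) * max 0 ?c"
        unfolding right_diff_distrib[symmetric] using \<epsilon> by (intro mult_left_mono) auto
      moreover have "(1 - \<epsilon>) * (2 * (real m + W)) \<le> 1 * (2 * (real m + W))"
        using \<epsilon> W0 by (intro mult_right_mono) auto
      ultimately show ?thesis by simp
    qed
    also have "\<dots> \<le> measure (errors E F) (A m) * max 0 ?c"
      using m by (intro mult_right_mono) auto
    also have "\<dots> = (\<integral>u. indicator (A m) u * max 0 ?c \<partial>errors E F)"
      using sets.sets_into_space[OF A, of m] by (simp add: Int_absorb2)
    also have "\<dots> \<le> (\<integral>u. (\<Sum>i\<in>UNIV. share x j i u * real (x i)) \<partial>errors E F)"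
    proof (rule integral_mono)
      fix u
      have nn: "0 \<le> (\<Sum>i\<in>UNIV. share x j i u * real (x i))" by (intro sum_nonneg) (simp add: share_nonneg)
      show "indicator (A m) u * max 0 ?c \<le> (\<Sum>i\<in>UNIV. share x j i u * real (x i))"
        using nn sum_share_weighted_ge[OF _ jk W, of u "real m" x]
        by (auto simp: A_def split: split_indicator)
    qed (auto intro!: Bochner_Integration.integrable_sum integrable_mult_left A_int)
    also have "\<dots> = (\<Sum>i\<in>UNIV. \<nu> x j i * real (x i))"
      unfolding match_prob_share by (simp add: Bochner_Integration.integral_sum)
    finally show "(1 - \<epsilon>) * real (x k) - 2 * (real m + W) \<le> (\<Sum>i\<in>UNIV. \<nu> x j i * real (x i))" .
  qed
qed

section \<open>The generator and its jump kernel\<close>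

text \<open>The generator regrouped by the class of the arriving item. Its inner sum is an average
  with weights \<open>\<nu> x j\<close>, which sum to 1 for a blocked class \<open>j\<close>, so
  drift bounds can be made one arrival at a time.\<close>

lemma generator_alt:
  "L h x = (\<Sum>j\<in>UNIV. lam j *
        (if j \<in> blocked x then \<Sum>i\<in>UNIV. \<nu> x j i * (h (x(i := x i - 1)) - h x)
         else h (x(j := x j + 1)) - h x))
    + (\<Sum>i\<in>UNIV. \<gamma> i * real (x i) * (h (x(i := x i - 1)) - h x))"
proof -
  let ?\<Delta> = "\<lambda>i. h (x(i := x i - 1)) - h x"
  have up: "(\<Sum>i\<in>- blocked x. lam i * (h (x(i := x i + 1)) - h x))
      = (\<Sum>i\<in>UNIV. if i \<in> blocked x then 0 else lam i * (h (x(i := x i + 1)) - h x))"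
    by (simp add: sum.If_cases)
  have "(\<Sum>i\<in>supp x. (\<gamma> i * real (x i) + (\<Sum>j\<in>neighbours E {i}. lam j * \<nu> x j i)) * ?\<Delta> i)
      = (\<Sum>i\<in>UNIV. \<gamma> i * real (x i) * ?\<Delta> i + (\<Sum>j\<in>UNIV. lam j * (\<nu> x j i * ?\<Delta> i)))"
  proof (rule sum.mono_neutral_cong_left)
    show "\<forall>i\<in>UNIV - supp x. \<gamma> i * real (x i) * ?\<Delta> i + (\<Sum>j\<in>UNIV. lam j * (\<nu> x j i * ?\<Delta> i)) = 0"
    proof
      fix i assume i: "i \<in> UNIV - supp x"
      then have "i \<notin> candidates x j" for j by (simp add: candidates_def supp_def)
      then show "\<gamma> i * real (x i) * ?\<Delta> i + (\<Sum>j\<in>UNIV. lam j * (\<nu> x j i * ?\<Delta> i)) = 0"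
        using i by (simp add: match_prob_eq_0 supp_def)
    qed
    fix i
    have "(\<Sum>j\<in>neighbours E {i}. lam j * \<nu> x j i) = (\<Sum>j\<in>UNIV. lam j * \<nu> x j i)"
    proof (rule sum.mono_neutral_left)
      show "\<forall>j\<in>UNIV - neighbours E {i}. lam j * \<nu> x j i = 0"
        using match_prob_eq_0 by (auto simp: candidates_def in_neighbours_singleton edge_sym)
    qed auto
    then show "(\<gamma> i * real (x i) + (\<Sum>j\<in>neighbours E {i}. lam j * \<nu> x j i)) * ?\<Delta> i
        = \<gamma> i * real (x i) * ?\<Delta> i + (\<Sum>j\<in>UNIV. lam j * (\<nu> x j i * ?\<Delta> i))"
      by (simp add: distrib_right sum_distrib_right mult.assoc)
  qed auto
  also have "\<dots> = (\<Sum>i\<in>UNIV. \<gamma> i * real (x i) * ?\<Delta> i) + (\<Sum>j\<in>UNIV. lam j * (\<Sum>i\<in>UNIV. \<nu> x j i * ?\<Delta> i))"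
    unfolding sum_distrib_left sum.distrib by (intro arg_cong2[where f="(+)"] refl sum.swap)
  finally have down: "(\<Sum>i\<in>supp x. (\<gamma> i * real (x i) + (\<Sum>j\<in>neighbours E {i}. lam j * \<nu> x j i)) * ?\<Delta> i)
      = (\<Sum>i\<in>UNIV. \<gamma> i * real (x i) * ?\<Delta> i) + (\<Sum>j\<in>UNIV. lam j * (\<Sum>i\<in>UNIV. \<nu> x j i * ?\<Delta> i))" .
  have "\<nu> x j i = 0" if "j \<notin> blocked x" for j i
    using that match_prob_eq_0 candidates_empty_iff by blast
  then have key: "(if j \<in> blocked x then 0 else lam j * (h (x(j := x j + 1)) - h x))
      + lam j * (\<Sum>i\<in>UNIV. \<nu> x j i * ?\<Delta> i)
    = lam j * (if j \<in> blocked x then \<Sum>i\<in>UNIV. \<nu> x j i * ?\<Delta> i else h (x(j := x j + 1)) - h x)" for j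
    by simp
  show ?thesis unfolding mw_generator_def up down key[symmetric] sum.distrib by (simp only: add_ac)
qed

section \<open>Transition rates and the jump kernel\<close>

definition moves :: "('v \<Rightarrow> nat) \<Rightarrow> ('v \<Rightarrow> nat) set" where
  "moves x = (\<lambda>i. x(i := x i + 1)) ` (- blocked x) \<union> (\<lambda>i. x(i := x i - 1)) ` supp x"

lemma finite_moves [simp]: "finite (moves x)"
  by (simp add: moves_def)

lemma not_in_moves: "x \<notin> moves x"
  by (auto simp: moves_def supp_def fun_upd_idem_iff dest!: HOL.sym[of x])

lemma generator_cong:
  assumes "\<And>y. y \<in> insert x (moves x) \<Longrightarrow> h y = h' y"
  shows "L h x = L h' x"
  unfolding mw_generator_def using assms by (intro arg_cong2[where f="(+)"] sum.cong) (auto simp: moves_def)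

lemma generator_add: "L (\<lambda>y. h y + h' y) x = L h x + L h' x"
  and generator_cmult: "L (\<lambda>y. c * h y) x = c * L h x"
  unfolding mw_generator_def by (simp_all add: algebra_simps sum.distrib sum_distrib_left sum_subtractf)

lemma generator_const: "L (\<lambda>_. c) x = 0"
  unfolding mw_generator_def by simp

lemma generator_sum: "finite A \<Longrightarrow> L (\<lambda>y. \<Sum>z\<in>A. h z y) x = (\<Sum>z\<in>A. L (h z) x)"
  by (induction A rule: finite_induct) (simp_all add: generator_const generator_add)

text \<open>\<open>L\<close> at \<open>x\<close> reads only finitely many values of
  \<open>h\<close>; there \<open>h\<close> is a combination of point indicators, and linearity does
  the rest.\<close>

lemma generator_eq_sum_rates:
  assumes "finite A" "insert x (moves x) \<subseteq> A"
  shows "L h x = (\<Sum>z\<in>A. h z * transition_rate L x z)"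
proof -
  have "L h x = L (\<lambda>y. \<Sum>z\<in>A. h z * indicator {z} y) x"
  proof (rule generator_cong)
    fix y assume "y \<in> insert x (moves x)"
    then have "y \<in> A" using assms(2) by auto
    then have "(\<Sum>z\<in>A. h z * indicator {z} y) = (\<Sum>z\<in>A. if z = y then h z else 0)"
      by (intro sum.cong) auto
    then show "h y = (\<Sum>z\<in>A. h z * indicator {z} y)" using assms(1) \<open>y \<in> A\<close> by simp
  qed
  also have "\<dots> = (\<Sum>z\<in>A. L (\<lambda>y. h z * indicator {z} y) x)"
    by (rule generator_sum[OF assms(1)])
  finally show ?thesis by (simp only: generator_cmult transition_rate_def)
qed

lemma transition_rate_eq_0: "z \<notin> insert x (moves x) \<Longrightarrow> transition_rate L x z = 0"
  unfolding transition_rate_def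
  by (subst generator_const[of 0 x, symmetric], rule generator_cong) (auto simp: indicator_def)

definition down_rate :: "('v \<Rightarrow> nat) \<Rightarrow> 'v \<Rightarrow> real" where
  "down_rate x i = \<gamma> i * real (x i) + (\<Sum>j\<in>neighbours E {i}. lam j * \<nu> x j i)"

lemma down_rate_nonneg: "0 \<le> down_rate x i"
  unfolding down_rate_def using gamma_nonneg lam_pos
  by (intro add_nonneg_nonneg sum_nonneg mult_nonneg_nonneg match_prob_nonneg) (auto simp: less_imp_le)

lemma transition_rate_off_diagonal:
  assumes "z \<noteq> x"
  shows "transition_rate L x z = (\<Sum>i\<in>- blocked x. lam i * indicator {z} (x(i := x i + 1)))
    + (\<Sum>i\<in>supp x. down_rate x i * indicator {z} (x(i := x i - 1)))"
  unfolding transition_rate_def mw_generator_def down_rate_def using assms by simp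

lemma transition_rate_nonneg: "z \<noteq> x \<Longrightarrow> 0 \<le> transition_rate L x z"
  unfolding transition_rate_off_diagonal
  by (intro add_nonneg_nonneg sum_nonneg mult_nonneg_nonneg) (auto simp: down_rate_nonneg less_imp_le[OF lam_pos])

lemma exit_rate_eq: "exit_rate L x = sum lam UNIV + (\<Sum>i\<in>UNIV. \<gamma> i * real (x i))"
proof -
  have up: "indicator {x} (x(j := x j + 1)) = (0::real)" for j
    by (simp add: indicator_def fun_upd_idem_iff)
  \<comment> \<open>For \<open>x i = 0\<close> the truncated subtraction returns \<open>x\<close>
    itself. Such terms do no harm since their matching and reneging rates vanish.\<close>
  have down: "indicator {x} (x(i := x i - 1)) = (if 0 < x i then 0 else 1::real)" for i
    by (auto simp: indicator_def fun_upd_idem_iff)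
  have "\<nu> x j i * (indicator {x} (x(i := x i - 1)) - indicator {x} x) = - \<nu> x j i" for i j
    unfolding down using match_prob_eq_0[of i x j] by (auto simp: candidates_def)
  moreover have "\<gamma> i * real (x i) * (indicator {x} (x(i := x i - 1)) - indicator {x} x) = - (\<gamma> i * real (x i))" for i
    unfolding down by auto
  ultimately show ?thesis
    unfolding exit_rate_def transition_rate_def generator_alt up
    by (simp add: sum_negf sum_match_prob if_distrib[of "(*) _"] cong: if_cong)
qed

lemma exit_rate_ge: "sum lam UNIV \<le> exit_rate L x"
  unfolding exit_rate_eq using gamma_nonneg by (simp add: sum_nonneg)

lemma sum_lam_pos: "0 < sum lam UNIV"
  using lam_pos by (intro sum_pos) auto

lemma exit_rate_pos: "0 < exit_rate L x"
  using exit_rate_ge sum_lam_pos by (rule less_le_trans[rotated])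

lemma pmf_jump:
  "pmf (jump_kernel L x) z = (if z = x then 0 else transition_rate L x z / exit_rate L x)"
proof (rule pmf_jump_kernel)
  have sub: "{z. transition_rate L x z \<noteq> 0} \<subseteq> insert x (moves x)"
    using transition_rate_eq_0 by blast
  then show "finite {z. transition_rate L x z \<noteq> 0}" by (rule finite_subset) simp
  have "(\<Sum>z | transition_rate L x z \<noteq> 0. transition_rate L x z) = (\<Sum>z\<in>insert x (moves x). transition_rate L x z)"
    using sub by (intro sum.mono_neutral_left) auto
  \<comment> \<open>The whole row of rates, diagonal included, sums to \<open>L\<close> of the
    constant 1, which is 0.\<close>
  also have "\<dots> = L (\<lambda>_. 1) x" by (subst generator_eq_sum_rates[of "insert x (moves x)"]) auto
  finally show "(\<Sum>z | transition_rate L x z \<noteq> 0. transition_rate L x z) = 0"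
    by (simp add: generator_const)
qed (use transition_rate_nonneg exit_rate_pos[of x] in auto)

lemma set_pmf_jump: "set_pmf (jump_kernel L x) \<subseteq> moves x"
proof
  fix z assume "z \<in> set_pmf (jump_kernel L x)"
  then have "z \<noteq> x" "transition_rate L x z \<noteq> 0"
    by (auto simp: set_pmf_iff pmf_jump split: if_splits)
  then show "z \<in> moves x" using transition_rate_eq_0 by blast
qed

lemma finite_set_pmf_jump: "finite (set_pmf (jump_kernel L x))"
  by (rule finite_subset[OF set_pmf_jump finite_moves])

text \<open>The link between the two time scales: a drift of \<open>L\<close> becomes a mean
  increment of the jump chain after division by the exit rate.\<close>

lemma expectation_jump:
  "measure_pmf.expectation (jump_kernel L x) h = h x + L h x / exit_rate L x"
proof -
  have "measure_pmf.expectation (jump_kernel L x) h = (\<Sum>z\<in>moves x. pmf (jump_kernel L x) z * h z)"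
    by (subst integral_measure_pmf[OF finite_moves]) (use set_pmf_jump in auto)
  also have "\<dots> = (\<Sum>z\<in>moves x. h z * transition_rate L x z) / exit_rate L x"
    unfolding sum_divide_distrib using not_in_moves by (intro sum.cong) (auto simp: pmf_jump)
  also have "(\<Sum>z\<in>moves x. h z * transition_rate L x z) = L h x + h x * exit_rate L x"
    unfolding exit_rate_def
    by (subst generator_eq_sum_rates[of "insert x (moves x)"]) (auto simp: not_in_moves)
  finally show ?thesis using exit_rate_pos[of x] by (simp add: add_divide_distrib)
qed

lemma nn_integral_jump:
  "(\<And>y. 0 \<le> h y) \<Longrightarrow> (\<integral>\<^sup>+z. ennreal (h z) \<partial>measure_pmf (jump_kernel L x)) = ennreal (h x + L h x / exit_rate L x)"
  by (subst nn_integral_eq_integral)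
    (auto simp: expectation_jump intro: integrable_measure_pmf_finite[OF finite_set_pmf_jump])

lemma up_in_set_pmf:
  assumes "i \<notin> blocked x"
  shows "x(i := x i + 1) \<in> set_pmf (jump_kernel L x)"
proof -
  let ?z = "x(i := x i + 1)"
  have "?z \<in> moves x" using assms by (auto simp: moves_def)
  then have ne: "?z \<noteq> x" using not_in_moves by metis
  have "lam i * indicator {?z} ?z \<le> (\<Sum>i\<in>- blocked x. lam i * indicator {?z} (x(i := x i + 1)))"
    using assms lam_pos by (intro member_le_sum) (auto simp: less_imp_le)
  moreover have "0 \<le> (\<Sum>i\<in>supp x. down_rate x i * indicator {?z} (x(i := x i - 1)))"
    by (intro sum_nonneg) (simp add: down_rate_nonneg)
  ultimately have "0 < transition_rate L x ?z"
    unfolding transition_rate_off_diagonal[OF ne] using lam_pos[of i] by simp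
  then show ?thesis using ne exit_rate_pos[of x] by (simp add: set_pmf_iff pmf_jump)
qed

lemma down_in_set_pmf:
  assumes "i \<in> supp x" "0 < down_rate x i"
  shows "x(i := x i - 1) \<in> set_pmf (jump_kernel L x)"
proof -
  let ?z = "x(i := x i - 1)"
  have "?z \<in> moves x" using assms by (auto simp: moves_def)
  then have ne: "?z \<noteq> x" using not_in_moves by metis
  have "down_rate x i * indicator {?z} ?z \<le> (\<Sum>i\<in>supp x. down_rate x i * indicator {?z} (x(i := x i - 1)))"
    using assms by (intro member_le_sum) (auto simp: down_rate_nonneg)
  moreover have "0 \<le> (\<Sum>i\<in>- blocked x. lam i * indicator {?z} (x(i := x i + 1)))"
    using lam_pos by (intro sum_nonneg) (simp add: less_imp_le)
  ultimately have "0 < transition_rate L x ?z"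
    unfolding transition_rate_off_diagonal[OF ne] using assms(2) by simp
  then show ?thesis using ne exit_rate_pos[of x] by (simp add: set_pmf_iff pmf_jump)
qed

section \<open>Invariance of the state space\<close>

lemma states_iff: "x \<in> states E \<longleftrightarrow> (\<forall>i j. (i, j) \<in> E \<longrightarrow> x i = 0 \<or> x j = 0)"
  by (simp add: states_def Ball_def split_paired_All)

lemma moves_states:
  assumes "x \<in> states E"
  shows "moves x \<subseteq> states E"
proof
  fix z assume "z \<in> moves x"
  then consider i where "i \<notin> blocked x" "z = x(i := x i + 1)" | i where "z = x(i := x i - 1)"
    by (auto simp: moves_def)
  then show "z \<in> states E"
  proof cases
    case 1
    \<comment> \<open>An unblocked class has only empty neighbouring queues, so storing one more of
      its items creates no conflict.\<close>
    have x0: "x k = 0" if "(i, k) \<in> E \<or> (k, i) \<in> E" for k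
      using 1(1) that edge_sym by (auto simp: neighbours_def supp_def)
    show ?thesis unfolding states_iff
    proof (intro allI impI)
      fix a b assume ab: "(a, b) \<in> E"
      have "a \<noteq> b" using ab irrefl by (auto simp: irrefl_def)
      then show "z a = 0 \<or> z b = 0"
        using ab x0 assms unfolding 1(2) states_iff by (cases "a = i"; cases "b = i") auto
    qed
  next
    case 2
    show ?thesis unfolding states_iff
    proof (intro allI impI)
      fix a b assume "(a, b) \<in> E"
      then have "x a = 0 \<or> x b = 0" using assms by (simp add: states_iff)
      then show "z a = 0 \<or> z b = 0" by (auto simp: 2)
    qed
  qed
qed

lemma jump_closed: "x \<in> states E \<Longrightarrow> set_pmf (jump_kernel L x) \<subseteq> states E"
  using set_pmf_jump moves_states by blast

section \<open>Necessity of the stability condition\<close>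

lemma generator_mono:
  assumes "\<And>z. z \<in> moves x \<Longrightarrow> h' z - h' x \<le> h z - h x"
  shows "L h' x \<le> L h x"
  unfolding mw_generator_def down_rate_def[symmetric]
  by (intro add_mono sum_mono mult_left_mono assms)
    (auto simp: down_rate_nonneg less_imp_le[OF lam_pos] moves_def)

theorem not_positive_recurrent:
  assumes I: "I \<in> independent_sets E {i. \<gamma> i = 0}" and ge: "sum lam (neighbours E I) \<le> sum lam I"
  shows "\<not> positive_recurrent_state L (\<lambda>_. 0)"
proof -
  define s :: "'v \<Rightarrow> real" where "s i = (if i \<in> I then 1 else if i \<in> neighbours E I then - 1 else 0)" for i
  define f where "f x = (\<Sum>i\<in>UNIV. s i * real (x i))" for x
  define g where "g x = max 0 (f x)" for x
  have disj: "I \<inter> neighbours E I = {}" using I by (auto simp: independent_sets_def neighbours_def)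
  \<comment> \<open>An edge with one end in \<open>I\<close> has the other in
    \<open>neighbours E I\<close>. Hence matching an arriving \<open>j\<close> with a stored
    \<open>i\<close> changes \<open>f\<close> by \<open>- s i\<close>, which is at least
    \<open>s j\<close>.\<close>
  have s_edge: "s i + s j \<le> 0" if "(i, j) \<in> E" for i j
    using that disj I edge_sym by (auto simp: s_def neighbours_def independent_sets_def)
  have s_abs: "\<bar>s i\<bar> \<le> 1" for i by (simp add: s_def)
  \<comment> \<open>Classes in \<open>I\<close> do not renege, so reneging never lowers
    \<open>f\<close>.\<close>
  have s_gamma: "s i \<le> 0 \<or> \<gamma> i = 0" for i using I by (auto simp: s_def independent_sets_def)
  have f_upd: "f (x(i := n)) = f x + s i * (real n - real (x i))" for x i n
  proof -
    have "f (x(i := n)) - f x = (\<Sum>k\<in>UNIV. if k = i then s i * (real n - real (x i)) else 0)"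
      unfolding f_def sum_subtractf[symmetric] by (intro sum.cong) (auto simp: right_diff_distrib)
    then show ?thesis by simp
  qed
  have f_down: "f (x(i := x i - 1)) - f x = - s i" if "0 < x i" for x i
    using that by (subst f_upd) (simp add: of_nat_diff)
  have f_up: "f (x(i := x i + 1)) - f x = s i" for x i
    by (subst f_upd) simp
  have f_moves: "\<bar>f z - f x\<bar> \<le> 1" if "z \<in> moves x" for x z
    using that s_abs f_down[of x] f_up[of x] by (auto simp: moves_def supp_def)

  have drift_f: "0 \<le> L f x" for x
  proof -
    \<comment> \<open>Storing a \<open>j\<close>-item changes \<open>f\<close> by exactly
      \<open>s j\<close>, and a match changes it by at least that. Summing over arrivals gives a
      drift of at least \<open>lam(I) - lam(E(I))\<close>.\<close>
    have "s j \<le> (if j \<in> blocked x then \<Sum>i\<in>UNIV. \<nu> x j i * (f (x(i := x i - 1)) - f x)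
         else f (x(j := x j + 1)) - f x)" for j
    proof (cases "j \<in> blocked x")
      case True
      have "s j = (\<Sum>i\<in>UNIV. \<nu> x j i * s j)" using sum_match_prob[OF True] by (simp flip: sum_distrib_right)
      also have "\<dots> \<le> (\<Sum>i\<in>UNIV. \<nu> x j i * (f (x(i := x i - 1)) - f x))"
      proof (rule sum_mono)
        fix i
        show "\<nu> x j i * s j \<le> \<nu> x j i * (f (x(i := x i - 1)) - f x)"
        proof (cases "i \<in> candidates x j")
          case True
          then have "0 < x i" "(j, i) \<in> E" by (auto simp: candidates_def in_neighbours_singleton)
          then show ?thesis using s_edge[of j i] f_down[of x i]
            by (intro mult_left_mono match_prob_nonneg) auto
        qed (simp add: match_prob_eq_0)
      qed
      finally show ?thesis using True by simp
    qed (use f_up[of x j] in simp)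
    then have "(\<Sum>j\<in>UNIV. lam j * s j) \<le> (\<Sum>j\<in>UNIV. lam j *
        (if j \<in> blocked x then \<Sum>i\<in>UNIV. \<nu> x j i * (f (x(i := x i - 1)) - f x)
         else f (x(j := x j + 1)) - f x))"
      by (intro sum_mono mult_left_mono) (auto simp: less_imp_le[OF lam_pos])
    moreover have "0 \<le> (\<Sum>i\<in>UNIV. \<gamma> i * real (x i) * (f (x(i := x i - 1)) - f x))"
    proof (rule sum_nonneg)
      fix i
      show "0 \<le> \<gamma> i * real (x i) * (f (x(i := x i - 1)) - f x)"
        using s_gamma[of i] f_down[of x i] gamma_nonneg[of i]
        by (cases "x i = 0") (auto simp: mult_nonneg_nonpos)
    qed
    moreover have "(\<Sum>j\<in>UNIV. lam j * s j) = sum lam I - sum lam (neighbours E I)"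
    proof -
      have "lam j * s j = (if j \<in> I then lam j else 0) - (if j \<in> neighbours E I then lam j else 0)" for j
        using disj by (auto simp: s_def)
      then show ?thesis by (simp add: sum_subtractf sum.If_cases)
    qed
    ultimately show ?thesis unfolding generator_alt[of f] using ge by linarith
  qed

  have drift_g: "0 \<le> L g x" for x
  proof -
    \<comment> \<open>With the coefficient frozen at the current state, this multiple of
      \<open>f\<close> agrees with \<open>g\<close> at \<open>x\<close> and lies below
      \<open>g\<close> everywhere, so the increments of \<open>g\<close> dominate.\<close>
    have "0 \<le> L (\<lambda>y. (if 0 < f x then 1 else 0) * f y) x"
      unfolding generator_cmult using drift_f by simp
    also have "\<dots> \<le> L g x" by (rule generator_mono) (auto simp: g_def)
    finally show ?thesis .
  qed
  have g0: "0 \<le> g y" for y by (simp add: g_def)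
  have zero: "(\<lambda>_. 0) \<in> states E" by (simp add: states_iff)
  have gz: "g (\<lambda>_. 0) = 0" by (simp add: g_def f_def)

  show ?thesis
  proof (rule not_positive_recurrent_state_submartingale[where S="states E" and g=g and C="sum lam UNIV"])
    show "ennreal (g y) \<le> (\<integral>\<^sup>+z. ennreal (g z) \<partial>measure_pmf (jump_kernel L y))" for y
      unfolding nn_integral_jump[OF g0] using drift_g exit_rate_pos[of y] by (intro ennreal_leI) simp
    obtain i where i: "i \<in> I" using I by (auto simp: independent_sets_def)
    let ?z = "(\<lambda>_. 0)(i := (0::nat) + 1)"
    have "i \<notin> blocked (\<lambda>_. 0)" by (auto simp: neighbours_def supp_def)
    from up_in_set_pmf[OF this] have "?z \<in> set_pmf (jump_kernel L (\<lambda>_. 0))" by simp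
    moreover have "f ?z = 1" using f_up[of "\<lambda>_. 0" i] i by (simp add: s_def f_def)
    then have "0 < g ?z" by (simp add: g_def)
    ultimately have "\<not> (AE z in measure_pmf (jump_kernel L (\<lambda>_. 0)). ennreal (g z) = 0)"
      unfolding AE_measure_pmf_iff by force
    then show "0 < (\<integral>\<^sup>+z. ennreal (g z) \<partial>measure_pmf (jump_kernel L (\<lambda>_. 0)))"
      using nn_integral_0_iff_AE[of "\<lambda>z. ennreal (g z)" "measure_pmf (jump_kernel L (\<lambda>_. 0))"]
      by (auto simp: zero_less_iff_neq_zero)
    show "g y \<le> g z + 1" if "z \<in> set_pmf (jump_kernel L y)" for y z
      using f_moves[of z y] set_pmf_jump[of y] that by (auto simp: g_def)
    fix y
    let ?h = "indicator {z. g z < g y} :: _ \<Rightarrow> real"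
    have hy: "?h y = 0" by simp
    \<comment> \<open>The rate at which \<open>g\<close> steps down: arrivals contribute at most
      their total rate and reneging nothing. This bound does not grow with the state, although the
      exit rate may.\<close>
    have "L ?h y \<le> sum lam UNIV + 0"
      unfolding generator_alt[of ?h]
    proof (intro add_mono)
      have "(if j \<in> blocked y then \<Sum>i\<in>UNIV. \<nu> y j i * (?h (y(i := y i - 1)) - ?h y)
         else ?h (y(j := y j + 1)) - ?h y) \<le> 1" for j
      proof (cases "j \<in> blocked y")
        case True
        have "(\<Sum>i\<in>UNIV. \<nu> y j i * (?h (y(i := y i - 1)) - ?h y)) \<le> (\<Sum>i\<in>UNIV. \<nu> y j i * 1)"
          by (intro sum_mono mult_left_mono match_prob_nonneg) (auto split: split_indicator)
        then show ?thesis using True by (simp add: sum_match_prob)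
      qed (auto split: split_indicator)
      then have "lam j * (if j \<in> blocked y then \<Sum>i\<in>UNIV. \<nu> y j i * (?h (y(i := y i - 1)) - ?h y)
         else ?h (y(j := y j + 1)) - ?h y) \<le> lam j * 1" for j
        by (intro mult_left_mono) (auto simp: less_imp_le[OF lam_pos])
      then show "(\<Sum>j\<in>UNIV. lam j * (if j \<in> blocked y then \<Sum>i\<in>UNIV. \<nu> y j i * (?h (y(i := y i - 1)) - ?h y)
         else ?h (y(j := y j + 1)) - ?h y)) \<le> sum lam UNIV"
        by (intro sum_mono) (simp del: of_nat_Suc)
      show "(\<Sum>i\<in>UNIV. \<gamma> i * real (y i) * (?h (y(i := y i - 1)) - ?h y)) \<le> 0"
      proof (rule sum_nonpos)
        fix i
        show "\<gamma> i * real (y i) * (?h (y(i := y i - 1)) - ?h y) \<le> 0"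
        proof (cases "\<gamma> i = 0 \<or> y i = 0")
          case False
          then have "g y \<le> g (y(i := y i - 1))" using s_gamma[of i] f_down[of y i] by (auto simp: g_def)
          then show ?thesis by simp
        qed auto
      qed
    qed
    then have "L ?h y / exit_rate L y \<le> sum lam UNIV * (1 / exit_rate L y)"
      using exit_rate_pos[of y] by (simp add: divide_right_mono)
    moreover have "emeasure (measure_pmf (jump_kernel L y)) {z. g z < g y}
        = (\<integral>\<^sup>+z. ennreal (?h z) \<partial>measure_pmf (jump_kernel L y))"
      by (simp add: ennreal_indicator)
    ultimately show "emeasure (measure_pmf (jump_kernel L y)) {z. g z < g y}
        \<le> ennreal (sum lam UNIV) * (1 / ennreal (exit_rate L y))"
      using exit_rate_pos[of y] sum_lam_pos
      by (simp add: nn_integral_jump divide_ennreal ennreal_mult[symmetric] ennreal_leI flip: ennreal_1)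
  qed (use zero gz g0 jump_closed exit_rate_pos in auto)
qed

section \<open>Sufficiency of the stability condition\<close>

abbreviation "patient \<equiv> {i. \<gamma> i = 0}"

lemma level_set_independent:
  assumes "x \<in> states E" "1 \<le> t" "i \<in> patient" "t \<le> x i"
  shows "{i \<in> patient. t \<le> x i} \<in> independent_sets E patient"
  using assms by (fastforce simp: independent_sets_def states_iff)

text \<open>
  Sum the inequality for the level sets \<open>{i \<in> patient. t \<le> x i}\<close> over \<open>t = 1, \<dots>, M\<close>; then \<open>m j\<close>
  counts the levels whose neighbourhood contains \<open>j\<close>.
\<close>

lemma Ncond_layer_cake:
  assumes x: "x \<in> states E"
    and \<eta>: "\<And>I. I \<in> independent_sets E patient \<Longrightarrow> sum lam I + \<eta> \<le> sum lam (neighbours E I)"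
    and M: "\<And>i. i \<in> patient \<Longrightarrow> x i \<le> M" "M = 0 \<or> (\<exists>i\<in>patient. x i = M)"
  obtains m :: "'v \<Rightarrow> nat" where
    "(\<Sum>i\<in>patient. lam i * real (x i)) + \<eta> * real M \<le> (\<Sum>j\<in>UNIV. lam j * real (m j))"
    "\<And>j. m j \<le> M" "\<And>j. 0 < m j \<Longrightarrow> \<exists>k. (j, k) \<in> E \<and> m j \<le> x k"
proof -
  define A where "A t = {i \<in> patient. t \<le> x i}" for t
  define m where "m j = card {t \<in> {1..M}. j \<in> neighbours E (A t)}" for j
  have m_le: "m j \<le> M" for j
  proof -
    have "m j \<le> card {1..M}" unfolding m_def by (rule card_mono) auto
    then show ?thesis by simp
  qed
  have m_ex: "\<exists>k. (j, k) \<in> E \<and> m j \<le> x k" if "0 < m j" for j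
  proof -
    let ?T = "{t \<in> {1..M}. j \<in> neighbours E (A t)}"
    have ne: "?T \<noteq> {}" using that unfolding m_def by (metis card.empty less_irrefl)
    have "Max ?T \<in> ?T" by (rule Max_in[OF _ ne]) simp
    then obtain k where k: "(j, k) \<in> E" "Max ?T \<le> x k"
      by (auto simp: neighbours_def A_def)
    have "?T \<subseteq> {1..Max ?T}" by auto
    then have "m j \<le> Max ?T" unfolding m_def using card_mono[of "{1..Max ?T}" ?T] by simp
    \<comment> \<open>All levels counted by \<open>m j\<close> lie between 1 and the highest of
      them, so a neighbour reaching the highest has a queue of at least \<open>m j\<close>.\<close>
    then show ?thesis using k by (intro exI[of _ k]) simp
  qed
  have of_bool_card: "real (card {t \<in> {1..M}. P t}) = (\<Sum>t\<in>{1..M}. if P t then 1 else 0)" for P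
    by (simp add: sum.If_cases Int_def)
  have xi: "real (x i) = (\<Sum>t\<in>{1..M}. if t \<le> x i then 1 else 0)" if "i \<in> patient" for i
  proof -
    have "{t \<in> {1..M}. t \<le> x i} = {1..x i}" using M(1)[OF that] by auto
    then have "real (x i) = real (card {t \<in> {1..M}. t \<le> x i})" by simp
    then show ?thesis unfolding of_bool_card .
  qed
  have "(\<Sum>i\<in>patient. lam i * real (x i)) = (\<Sum>i\<in>patient. \<Sum>t\<in>{1..M}. if t \<le> x i then lam i else 0)"
    using xi by (intro sum.cong) (auto simp: sum_distrib_left if_distrib[of "(*) _"] cong: if_cong)
  also have "\<dots> = (\<Sum>t\<in>{1..M}. sum lam (A t))"
    by (subst sum.swap) (simp add: A_def sum.If_cases Int_def)
  also have "\<dots> \<le> (\<Sum>t\<in>{1..M}. sum lam (neighbours E (A t)) - \<eta>)"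
  proof (rule sum_mono)
    fix t assume t: "t \<in> {1..M}"
    then obtain i where "i \<in> patient" "x i = M" using M(2) by auto
    \<comment> \<open>A longest patient queue belongs to every level set up to \<open>M\<close>; all
      of them are nonempty, and the slack \<open>\<eta>\<close> is gained \<open>M\<close>
      times.\<close>
    then have "A t \<in> independent_sets E patient"
      unfolding A_def using t by (intro level_set_independent[OF x]) auto
    then show "sum lam (A t) \<le> sum lam (neighbours E (A t)) - \<eta>" using \<eta>[of "A t"] by simp
  qed
  also have "\<dots> = (\<Sum>t\<in>{1..M}. sum lam (neighbours E (A t))) - \<eta> * real M"
    by (simp add: sum_subtractf)
  also have "(\<Sum>t\<in>{1..M}. sum lam (neighbours E (A t)))
      = (\<Sum>t\<in>{1..M}. \<Sum>j\<in>UNIV. if j \<in> neighbours E (A t) then lam j else 0)"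
    by (simp add: sum.If_cases)
  also have "\<dots> = (\<Sum>j\<in>UNIV. lam j * real (m j))"
    unfolding m_def of_bool_card by (subst sum.swap)
      (simp add: sum_distrib_left if_distrib[of "(*) _"] cong: if_cong)
  finally show thesis using that[of m] m_le m_ex by simp
qed

section \<open>Drift of the quadratic function\<close>

definition V :: "('v \<Rightarrow> nat) \<Rightarrow> real" where
  "V x = (\<Sum>i\<in>UNIV. (real (x i))\<^sup>2)"

lemma V_upd: "V (x(i := n)) - V x = (real n)\<^sup>2 - (real (x i))\<^sup>2"
proof -
  have "V (x(i := n)) - V x = (\<Sum>k\<in>UNIV. if k = i then (real n)\<^sup>2 - (real (x i))\<^sup>2 else 0)"
    unfolding V_def sum_subtractf[symmetric] by (intro sum.cong) auto
  then show ?thesis by simp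
qed

lemma V_up: "V (x(i := x i + 1)) - V x = 2 * real (x i) + 1"
  by (subst V_upd) (simp add: power2_eq_square algebra_simps)

lemma V_down: "0 < x i \<Longrightarrow> V (x(i := x i - 1)) - V x = 1 - 2 * real (x i)"
  by (subst V_upd) (simp add: power2_eq_square algebra_simps of_nat_diff)

text \<open>One formula serves both kinds of arrival: if \<open>j\<close> is not blocked, its
  matching probabilities are 0; if it is blocked, the formula only adds
  \<open>2 * real (x j)\<close>, which is 0 in a valid state.\<close>

lemma generator_V_le:
  "L V x \<le> (\<Sum>j\<in>UNIV. lam j * (2 * real (x j) + 1 - 2 * (\<Sum>i\<in>UNIV. \<nu> x j i * real (x i))))
    + (\<Sum>i\<in>UNIV. \<gamma> i * real (x i) * (1 - 2 * real (x i)))"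
proof -
  have "(if j \<in> blocked x then \<Sum>i\<in>UNIV. \<nu> x j i * (V (x(i := x i - 1)) - V x)
      else V (x(j := x j + 1)) - V x)
    \<le> 2 * real (x j) + 1 - 2 * (\<Sum>i\<in>UNIV. \<nu> x j i * real (x i))" for j
  proof (cases "j \<in> blocked x")
    case True
    have "\<nu> x j i * (V (x(i := x i - 1)) - V x) = \<nu> x j i - 2 * (\<nu> x j i * real (x i))" for i
    proof (cases "i \<in> candidates x j")
      case True
      then show ?thesis using V_down[of x i] by (simp add: candidates_def right_diff_distrib)
    qed (simp add: match_prob_eq_0)
    then show ?thesis using True by (simp add: sum_subtractf sum_match_prob sum_distrib_left)
  next
    case False
    then have "\<nu> x j i = 0" for i using candidates_empty_iff match_prob_eq_0 by blast
    then show ?thesis using False V_up[of x j] by simp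
  qed
  moreover have reneging: "\<gamma> i * real (x i) * (V (x(i := x i - 1)) - V x) = \<gamma> i * real (x i) * (1 - 2 * real (x i))" for i
    using V_down[of x i] by (cases "x i = 0") auto
  ultimately show ?thesis
    unfolding generator_alt[of V] reneging using lam_pos
    by (intro add_right_mono sum_mono mult_left_mono) (auto simp: less_imp_le)
qed

text \<open>The patient classes supply a decrease of \<open>2 * \<eta> * M\<close>, half of which
  covers the loss from the errors. In the other classes reneging is quadratic and beats every linear
  term. The exit rate is split off so that, divided by it, the drift is at most -1 far out even when
  exit rates are unbounded.\<close>

lemma generator_V_drift:
  assumes nc: "lam \<in> Ncond E \<gamma>"
  obtains K b where "0 < b"
    "\<And>x. x \<in> states E \<Longrightarrow> L V x \<le> K - b * (\<Sum>i\<in>UNIV. real (x i)) - exit_rate L x"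
proof -
  let ?\<Lambda> = "sum lam UNIV" and ?n = "real CARD('v)"
  let ?S = "\<lambda>I. sum lam (neighbours E I) - sum lam I"
  define \<eta> where "\<eta> = Min (insert 1 (?S ` independent_sets E patient))"
  have "0 < \<eta>" unfolding \<eta>_def using nc by (subst Min_gr_iff) (auto simp: Ncond_def)
  have "\<eta> \<le> ?S I" if "I \<in> independent_sets E patient" for I
    unfolding \<eta>_def using that by (intro Min_le) auto
  then have \<eta>: "sum lam I + \<eta> \<le> sum lam (neighbours E I)" if "I \<in> independent_sets E patient" for I
    using that by force
  \<comment> \<open>Small enough that the doubled total loss
    \<open>2 * \<epsilon> * ?\<Lambda> * M\<close> is at most \<open>\<eta> * M\<close>.\<close>
  define \<epsilon> where "\<epsilon> = min (1 / 2) (\<eta> / (2 * ?\<Lambda>))"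
  have "0 < \<epsilon>" "\<epsilon> < 1" using \<open>0 < \<eta>\<close> sum_lam_pos by (auto simp: \<epsilon>_def)
  have "\<epsilon> \<le> \<eta> / (2 * ?\<Lambda>)" by (simp add: \<epsilon>_def)
  then have \<epsilon>\<Lambda>: "2 * \<epsilon> * ?\<Lambda> \<le> \<eta>" using sum_lam_pos by (simp add: field_simps)
  obtain K where K: "0 \<le> K"
    "\<And>x j k. (j, k) \<in> E \<Longrightarrow> (1 - \<epsilon>) * real (x k) - K \<le> (\<Sum>i\<in>UNIV. \<nu> x j i * real (x i))"
    using match_prob_weighted_ge[OF \<open>0 < \<epsilon>\<close> \<open>\<epsilon> < 1\<close>] by blast
  \<comment> \<open>The maximum over \<open>y\<close> of \<open>(2 * lam i + 2 * \<gamma> i + 1) * y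
    - 2 * \<gamma> i * y\<^sup>2\<close>, found by completing the square. The coefficient reserves
    \<open>\<gamma> i * y\<close> for the exit rate and \<open>y\<close> for the final
    decrease.\<close>
  define Q where "Q i = (2 * lam i + 2 * \<gamma> i + 1)\<^sup>2 / (8 * \<gamma> i)" for i
  have Q: "2 * lam i * y + \<gamma> i * y - 2 * \<gamma> i * y\<^sup>2 \<le> Q i - (\<gamma> i + 1) * y" if "\<gamma> i \<noteq> 0" for i y
  proof -
    let ?c = "2 * lam i + 2 * \<gamma> i + 1"
    have g: "0 < \<gamma> i" using that gamma_nonneg[of i] by simp
    have "0 \<le> (4 * \<gamma> i * y - ?c)\<^sup>2" by simp
    then have "8 * \<gamma> i * (?c * y - 2 * \<gamma> i * y\<^sup>2) \<le> ?c\<^sup>2"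
      by (simp add: power2_eq_square algebra_simps)
    then have "?c * y - 2 * \<gamma> i * y\<^sup>2 \<le> Q i" unfolding Q_def using g by (simp add: pos_le_divide_eq mult.commute)
    then show ?thesis by (simp add: algebra_simps)
  qed
  define b where "b = min 1 (\<eta> / ?n)"
  show thesis
  proof
    show "0 < b" using \<open>0 < \<eta>\<close> by (simp add: b_def)
    fix x assume x: "x \<in> states E"
    let ?P = "\<lambda>j. \<Sum>i\<in>UNIV. \<nu> x j i * real (x i)"
    define M where "M = Max (insert 0 (x ` patient))"
    have M: "x i \<le> M" if "i \<in> patient" for i unfolding M_def using that by (intro Max_ge) auto
    have "M \<in> insert 0 (x ` patient)" unfolding M_def by (rule Max_in) auto
    then have M': "M = 0 \<or> (\<exists>i\<in>patient. x i = M)" by auto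
    obtain m where m: "(\<Sum>i\<in>patient. lam i * real (x i)) + \<eta> * real M \<le> (\<Sum>j\<in>UNIV. lam j * real (m j))"
      "\<And>j. m j \<le> M" "\<And>j. 0 < m j \<Longrightarrow> \<exists>k. (j, k) \<in> E \<and> m j \<le> x k"
      using Ncond_layer_cake[OF x \<eta> M M'] by blast
    \<comment> \<open>The level sets provide a neighbour with queue at least \<open>m j\<close>;
      Max-Weight does almost as well, up to the proportion \<open>\<epsilon>\<close> and the
      constant \<open>K\<close>.\<close>
    have P: "real (m j) - \<epsilon> * real M - K \<le> ?P j" for j
    proof (cases "0 < m j")
      case True
      then obtain k where k: "(j, k) \<in> E" "m j \<le> x k" using m(3) by blast
      have "\<epsilon> * real (m j) \<le> \<epsilon> * real M" using m(2)[of j] \<open>0 < \<epsilon>\<close> by simp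
      moreover have "(1 - \<epsilon>) * real (m j) \<le> (1 - \<epsilon>) * real (x k)"
        using k(2) \<open>\<epsilon> < 1\<close> by (intro mult_left_mono) auto
      moreover have "(1 - \<epsilon>) * real (m j) = real (m j) - \<epsilon> * real (m j)" by (simp add: left_diff_distrib)
      ultimately show ?thesis using K(2)[OF k(1), of x] by linarith
    next
      case False
      have "0 \<le> ?P j" by (intro sum_nonneg) (simp add: match_prob_nonneg)
      moreover have "0 \<le> \<epsilon> * real M" using \<open>0 < \<epsilon>\<close> by simp
      ultimately show ?thesis using False K(1) by simp
    qed
    have split: "(\<Sum>i\<in>UNIV. h i) = (\<Sum>i\<in>patient. h i) + (\<Sum>i\<in>-patient. h i)" for h :: "'v \<Rightarrow> real"
      using sum.union_disjoint[of patient "- patient" h] by (simp add: Compl_partition)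
    have "(\<Sum>j\<in>UNIV. lam j * (real (m j) - \<epsilon> * real M - K)) \<le> (\<Sum>j\<in>UNIV. lam j * ?P j)"
      using P lam_pos by (intro sum_mono mult_left_mono) (auto simp: less_imp_le)
    then have A1: "(\<Sum>j\<in>UNIV. lam j * real (m j)) - ?\<Lambda> * (\<epsilon> * real M) - ?\<Lambda> * K \<le> (\<Sum>j\<in>UNIV. lam j * ?P j)"
      by (simp add: right_diff_distrib sum_subtractf sum_distrib_right)
    have A2: "2 * (?\<Lambda> * (\<epsilon> * real M)) \<le> \<eta> * real M"
      using mult_right_mono[OF \<epsilon>\<Lambda>, of "real M"] by (simp add: mult_ac)
    have A3: "b * (\<Sum>i\<in>patient. real (x i)) \<le> \<eta> * real M"
    proof -
      have "(\<Sum>i\<in>patient. real (x i)) \<le> (\<Sum>i\<in>patient. real M)" using M by (intro sum_mono) simp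
      also have "\<dots> \<le> ?n * real M" by (simp add: card_mono mult_right_mono)
      finally have "b * (\<Sum>i\<in>patient. real (x i)) \<le> b * (?n * real M)"
        using \<open>0 < b\<close> by (intro mult_left_mono) auto
      also have "\<dots> \<le> \<eta> / ?n * (?n * real M)" unfolding b_def by (intro mult_right_mono) auto
      finally show ?thesis by simp
    qed
    have A4: "(\<Sum>i\<in>-patient. 2 * (lam i * real (x i)) + \<gamma> i * real (x i) * (1 - 2 * real (x i)))
      \<le> (\<Sum>i\<in>-patient. Q i - \<gamma> i * real (x i) - b * real (x i))"
    proof (rule sum_mono)
      fix i assume i: "i \<in> - patient"
      have "b * real (x i) \<le> 1 * real (x i)" unfolding b_def by (intro mult_right_mono) auto
      then show "2 * (lam i * real (x i)) + \<gamma> i * real (x i) * (1 - 2 * real (x i))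
          \<le> Q i - \<gamma> i * real (x i) - b * real (x i)"
        using Q[of i "real (x i)"] i by (simp add: algebra_simps power2_eq_square)
    qed
    have g1: "(\<Sum>i\<in>UNIV. \<gamma> i * real (x i)) = (\<Sum>i\<in>-patient. \<gamma> i * real (x i))"
      and g2: "(\<Sum>i\<in>UNIV. \<gamma> i * real (x i) * (1 - 2 * real (x i)))
        = (\<Sum>i\<in>-patient. \<gamma> i * real (x i) * (1 - 2 * real (x i)))"
      unfolding split by simp_all
    have e1: "(\<Sum>j\<in>UNIV. lam j * (2 * real (x j) + 1 - 2 * ?P j))
       = 2 * (\<Sum>j\<in>UNIV. lam j * real (x j)) + ?\<Lambda> - 2 * (\<Sum>j\<in>UNIV. lam j * ?P j)"
      by (simp add: algebra_simps sum.distrib sum_subtractf sum_distrib_left)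
    show "L V x \<le> (2 * ?\<Lambda> + 2 * (?\<Lambda> * K) + (\<Sum>i\<in>-patient. Q i)) - b * (\<Sum>i\<in>UNIV. real (x i)) - exit_rate L x"
      using generator_V_le[of x] A1 A2 A3 A4 m(1)
      unfolding exit_rate_eq g1 g2 e1 split[of "\<lambda>i. real (x i)"] split[of "\<lambda>i. lam i * real (x i)"]
      by (simp add: sum.distrib sum_subtractf distrib_left flip: sum_distrib_left)
  qed
qed

section \<open>Paths between states inside a finite set\<close>

abbreviation total :: "('v \<Rightarrow> nat) \<Rightarrow> nat" where
  "total x \<equiv> \<Sum>i\<in>UNIV. x i"

lemma total_upd: "total (x(i := n)) + x i = total x + n"
proof -
  have "total y = y i + (\<Sum>k\<in>UNIV - {i}. y k)" for y :: "'v \<Rightarrow> nat"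
    by (simp add: sum.remove)
  from this[of x] this[of "x(i := n)"] show ?thesis by simp
qed

definition small_states :: "nat \<Rightarrow> ('v \<Rightarrow> nat) set" where
  "small_states N = {x \<in> states E. total x \<le> N}"

lemma finite_small_states: "finite (small_states N)"
proof (rule finite_subset)
  have "x i \<le> total x" for x i by (rule member_le_sum) auto
  then show "small_states N \<subseteq> Pi\<^sub>E UNIV (\<lambda>_. {..N})"
    by (auto simp: small_states_def intro: order_trans)
qed (simp add: finite_PiE)

text \<open>Either class \<open>i\<close> reneges, or the condition for the singleton
  \<open>{i}\<close> forces \<open>i\<close> to have a neighbour \<open>j\<close>. An arriving
  \<open>j\<close>-item is then matched with some stored class \<open>k\<close>, which may differ
  from \<open>i\<close>.\<close>

lemma down_rate_pos_exists:
  assumes nc: "lam \<in> Ncond E \<gamma>" and x: "x i \<noteq> 0"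
  obtains k where "k \<in> supp x" "0 < down_rate x k"
proof (cases "\<gamma> i = 0")
  case False
  have "0 < \<gamma> i * real (x i)" using False gamma_nonneg[of i] x by simp
  moreover have "0 \<le> (\<Sum>j\<in>neighbours E {i}. lam j * \<nu> x j i)"
    using lam_pos by (intro sum_nonneg mult_nonneg_nonneg match_prob_nonneg) (simp add: less_imp_le)
  ultimately show ?thesis using that[of i] x by (simp add: down_rate_def supp_def)
next
  case True
  then have "{i} \<in> independent_sets E patient"
    using irrefl by (auto simp: independent_sets_def irrefl_def)
  then have "lam i < sum lam (neighbours E {i})" using nc by (force simp: Ncond_def)
  then have "neighbours E {i} \<noteq> {}" using lam_pos[of i] by (metis less_asym sum.empty)
  then obtain j where j: "j \<in> blocked x" using x by (auto simp: neighbours_def supp_def)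
  have "\<exists>k. \<nu> x j k \<noteq> 0" using sum_match_prob[OF j] by (metis sum.neutral zero_neq_one)
  then obtain k where k: "\<nu> x j k \<noteq> 0" ..
  then have kc: "k \<in> candidates x j" using match_prob_eq_0 by blast
  have "0 < lam j * \<nu> x j k" using k match_prob_nonneg[of x j k] lam_pos[of j] by simp
  also have "\<dots> \<le> (\<Sum>j\<in>neighbours E {k}. lam j * \<nu> x j k)"
  proof (rule member_le_sum)
    show "j \<in> neighbours E {k}"
      using kc by (simp add: candidates_def in_neighbours_singleton edge_sym)
  qed (auto simp: match_prob_nonneg less_imp_le[OF lam_pos])
  also have "\<dots> \<le> down_rate x k" using gamma_nonneg[of k] by (simp add: down_rate_def)
  finally show ?thesis using that[of k] kc by (simp add: candidates_def supp_def)
qed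

lemma reach_zero:
  assumes nc: "lam \<in> Ncond E \<gamma>" and y: "y \<in> small_states N"
  shows "(y, \<lambda>_. 0) \<in> {(y, z). z \<in> small_states N \<and> z \<in> set_pmf (jump_kernel L y)}\<^sup>*"
  using y
proof (induction "total y" arbitrary: y)
  case 0
  then have "y = (\<lambda>_. 0)" by auto
  then show ?case by simp
next
  case (Suc n)
  then obtain i where "y i \<noteq> 0" by (metis nat.distinct(1) sum.neutral)
  then obtain k where k: "k \<in> supp y" "0 < down_rate y k" by (rule down_rate_pos_exists[OF nc])
  let ?z = "y(k := y k - 1)"
  have step: "?z \<in> set_pmf (jump_kernel L y)" by (rule down_in_set_pmf[OF k])
  have "total ?z + 1 = total y" using total_upd[of y k "y k - 1"] k(1) by (simp add: supp_def)
  moreover from this have "?z \<in> small_states N"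
    using Suc.prems jump_closed[of y] step by (auto simp: small_states_def)
  ultimately show ?case
    using step Suc.hyps by (intro converse_rtrancl_into_rtrancl[of y ?z]) auto
qed

text \<open>Add the missing items one at a time. Intermediate states stay below \<open>x\<close> and
  so remain valid, and a class with \<open>x i > 0\<close> is never blocked below \<open>x\<close>
  because its neighbours are empty in \<open>x\<close>.\<close>

lemma reach_from_below:
  assumes x: "x \<in> small_states N" and "\<And>i. y i \<le> x i"
  shows "(y, x) \<in> {(y, z). z \<in> small_states N \<and> z \<in> set_pmf (jump_kernel L y)}\<^sup>*"
  using assms(2)
proof (induction "total x - total y" arbitrary: y rule: less_induct)
  case less
  show ?case
  proof (cases "y = x")
    case False
    then obtain i where i: "y i < x i" using less.prems by (metis ext le_neq_implies_less)
    let ?z = "y(i := y i + 1)"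
    have zle: "?z k \<le> x k" for k using i less.prems by simp
    have sz: "total ?z = total y + 1" using total_upd[of y i "y i + 1"] by simp
    have "total ?z \<le> total x" using zle by (intro sum_mono)
    have "i \<notin> blocked y"
    proof
      assume "i \<in> blocked y"
      then obtain k where k: "(i, k) \<in> E" "0 < y k" by (auto simp: neighbours_def supp_def)
      have "x i = 0 \<or> x k = 0" using x k(1) by (simp add: small_states_def states_iff)
      then show False using i k(2) less.prems[of k] by simp
    qed
    then have "?z \<in> set_pmf (jump_kernel L y)" by (rule up_in_set_pmf)
    moreover have "?z \<in> small_states N"
    proof -
      have "?z a = 0 \<or> ?z b = 0" if "(a, b) \<in> E" for a b
      proof -
        have "x a = 0 \<or> x b = 0" using that x by (simp add: small_states_def states_iff)
        then show ?thesis using zle[of a] zle[of b] by (metis le_zero_eq)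
      qed
      then show ?thesis
        using x \<open>total ?z \<le> total x\<close> by (auto simp: small_states_def states_iff simp del: fun_upd_apply)
    qed
    moreover have "(?z, x) \<in> {(y, z). z \<in> small_states N \<and> z \<in> set_pmf (jump_kernel L y)}\<^sup>*"
      using sz \<open>total ?z \<le> total x\<close> zle by (intro less.hyps) linarith+
    ultimately show ?thesis by (intro converse_rtrancl_into_rtrancl[of y ?z]) auto
  qed simp
qed

section \<open>Conclusion\<close>

theorem positive_recurrent_Ncond:
  assumes nc: "lam \<in> Ncond E \<gamma>"
  shows "positive_recurrent L (states E)"
  unfolding positive_recurrent_def
proof
  fix x assume x: "x \<in> states E"
  obtain K b where b: "0 < b"
    and drift: "\<And>x. x \<in> states E \<Longrightarrow> L V x \<le> K - b * (\<Sum>i\<in>UNIV. real (x i)) - exit_rate L x"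
    using generator_V_drift[OF nc] by blast
  obtain N0 :: nat where N0: "K / b \<le> real N0" using real_arch_simple by blast
  \<comment> \<open>Beyond \<open>N0\<close> items the linear term absorbs \<open>K\<close>; the
    maximum with \<open>total x\<close> places the target state inside the finite set. Paths through
    the empty state then connect every point of the set to \<open>x\<close>.\<close>
  define N where "N = max N0 (total x)"
  have xN: "x \<in> small_states N" using x by (simp add: small_states_def N_def)
  show "positive_recurrent_state L x"
  proof (rule positive_recurrent_state_lyapunov[where S="states E" and V=V and C="small_states N"
        and a=1 and r="sum lam UNIV"])
    fix y assume y: "y \<in> states E" "y \<notin> small_states N"
    then have "N0 \<le> total y" by (simp add: small_states_def N_def)
    then have "real N0 \<le> real (total y)" by (rule of_nat_mono)
    then have "K / b \<le> real (total y)" using N0 by (rule order_trans[rotated])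
    then have "K \<le> b * (\<Sum>i\<in>UNIV. real (y i))" using b by (simp add: pos_divide_le_eq mult.commute)
    then have "L V y \<le> - exit_rate L y" using drift[OF y(1)] by simp
    then have "L V y / exit_rate L y \<le> - 1" using exit_rate_pos[of y] by (simp add: pos_divide_le_eq)
    then show "measure_pmf.expectation (jump_kernel L y) V \<le> V y - 1"
      unfolding expectation_jump by simp
  next
    fix y assume "y \<in> small_states N"
    from reach_zero[OF nc this] reach_from_below[OF xN, of "\<lambda>_. 0"]
    show "(y, x) \<in> {(y, z). z \<in> small_states N \<and> z \<in> set_pmf (jump_kernel L y)}\<^sup>*"
      by (auto intro: rtrancl_trans)
  qed (use x jump_closed finite_set_pmf_jump sum_lam_pos exit_rate_ge finite_small_states in
      \<open>auto simp: V_def small_states_def intro: sum_nonneg\<close>)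
qed

end

theorem theorem3p2:
  fixes E :: "('v::finite \<times> 'v) set"
    and w :: "'v \<times> 'v \<Rightarrow> real"
    and F :: "'v \<times> 'v \<Rightarrow> real \<Rightarrow> real"
    and lam \<gamma> :: "'v \<Rightarrow> real"
  assumes "connected_simple_graph E"
    and "\<And>i. 0 \<le> \<gamma> i"
    and "\<And>e. e \<in> E \<Longrightarrow> 0 \<le> w e"
    and "\<And>e. e \<in> E \<Longrightarrow> is_cdf (F e)"
    and "\<And>i. 0 < lam i"
  shows "mw_stable E w F lam \<gamma> \<longleftrightarrow> lam \<in> Ncond E \<gamma>"
proof -
  interpret max_weight E w F lam \<gamma>
    using assms by unfold_locales (auto simp: connected_simple_graph_def)
  show ?thesis
  proof
    assume "lam \<in> Ncond E \<gamma>"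
    then show "mw_stable E w F lam \<gamma>" unfolding mw_stable_def by (rule positive_recurrent_Ncond)
  next
    assume "mw_stable E w F lam \<gamma>"
    \<comment> \<open>Stability covers the empty state, whose positive recurrence is ruled out by
      any violating independent set.\<close>
    then have "positive_recurrent_state (mw_generator E w F lam \<gamma>) (\<lambda>_. 0)"
      by (simp add: mw_stable_def positive_recurrent_def states_iff)
    then show "lam \<in> Ncond E \<gamma>"
      using not_positive_recurrent assms(5) by (force simp: Ncond_def not_less[symmetric])
  qed
qed

end
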